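(* Let $S,T$ and $P$ be Cu-semigroups. Then the natural bijection $$\mathrm{Cu}\big(S,[\![T,P]\!]\big)\cong\mathrm{Cu}\big(S\otimes T,P\big)$$ (which sends $\alpha$ to the Cu-morphism determined by $a\otimes b\mapsto\sigma_{T,P}(\alpha(a))(b)$) identifies a Cu-morphism $f\colon S\to[\![T,P]\!]$ with $$\mathrm e_{T,P}\circ(f\otimes\mathrm{id}_T)\colon S\otimes T\xrightarrow{f\otimes\mathrm{id}_T}[\![T,P]\!]\otimes T\xrightarrow{\mathrm e_{T,P}}P.$$ Conversely, a Cu-morphism $g\colon S\otimes T\to P$ is identified with $$g_*\circ\mathrm d_{S,T}\colon S\xrightarrow{\mathrm d_{S,T}}[\![T,S\otimes T]\!]\xrightarrow{g_*}[\![T,P]\!].$$ In particular, for all such $f$ and $g$, $$f=\big(\mathrm e_{T,P}\circ(f\otimes\mathrm{id}_T)\big)_*\circ\mathrm d_{S,T}\quad\text{and}\quad g=\mathrm e_{T,P}\circ\big((g_*\circ\mathrm d_{S,T})\otimes\mathrm{id}_T\big).$$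
   Context: A positively ordered semigroup is a commutative monoid $(S,+,0)$ with a partial order $\le$ compatible with addition such that $0\le a$ for all $a$. For $a,b\in S$, $a\ll b$ (way-below) means: whenever $(c_n)_n$ is an increasing sequence in $S$ whose supremum exists and satisfies $b\le\sup_n c_n$, there is $k$ with $a\le c_k$. A Cu-semigroup is a positively ordered semigroup satisfying: (O1) every increasing sequence has a supremum; (O2) every $a$ is the supremum of a sequence $(a_n)_n$ with $a_n\ll a_{n+1}$ for all $n$; (O3) $a'\ll a$ and $b'\ll b$ imply $a'+b'\ll a+b$; (O4) $\sup_n(a_n+b_n)=\sup_n a_n+\sup_n b_n$ for increasing sequences. A generalized Cu-morphism is a map between Cu-semigroups preserving addition, zero, order and suprema of increasing sequences; a Cu-morphism additionally preserves $\ll$. $\mathrm{Cu}[S,T]$ and $\mathrm{Cu}(S,T)$ denote the sets of generalized Cu-morphisms and of Cu-morphisms $S\to T$, with pointwise order and addition. A Cu-bimorphism $\varphi\colon S\times T\to P$ is a map that is additive, zero- and order-preserving in each variable, satisfies $\sup_k\varphi(a_k,b_k)=\varphi(\sup_k a_k,\sup_k b_k)$ for increasing sequences, and satisfies $\varphi(a',b')\ll\varphi(a,b)$ whenever $a'\ll a$ and $b'\ll b$. $S\otimes T$ denotes the Cu-semigroup with universal Cu-bimorphism $S\times T\to S\otimes T$, $(a,b)\mapsto a\otimes b$: every Cu-bimorphism $S\times T\to P$ factors through a unique Cu-morphism $S\otimes T\to P$, and Cu-morphisms $\alpha_1,\alpha_2\colon S\otimes T\to P$ satisfy $\alpha_1\le\alpha_2$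 iff $\alpha_1(a\otimes b)\le\alpha_2(a\otimes b)$ for all $a,b$. For Cu-morphisms $\varphi_1,\varphi_2$, $\varphi_1\otimes\varphi_2$ is the Cu-morphism with $(\varphi_1\otimes\varphi_2)(a\otimes b)=\varphi_1(a)\otimes\varphi_2(b)$. Let $I_{\mathbb Q}=\mathbb Q\cap(0,1)$. For $\varphi,\psi\in\mathrm{Cu}[S,T]$ write $\varphi\prec\psi$ if $\varphi(a')\ll\psi(a)$ whenever $a'\ll a$ in $S$. A path in $\mathrm{Cu}[S,T]$ is a family $\mathbf f=(f_\lambda)_{\lambda\in I_{\mathbb Q}}$ with $f_{\lambda'}\prec f_\lambda$ whenever $\lambda'<\lambda$. Write $\mathbf f\lesssim\mathbf g$ if for every $\lambda$ there is $\mu$ with $f_\lambda\prec g_\mu$. The internal hom $[\![S,T]\!]$ is the set of classes $[\mathbf f]$ of paths modulo ($\mathbf f\lesssim\mathbf g$ and $\mathbf g\lesssim\mathbf f$), with $[\mathbf f]+[\mathbf g]=[(f_\lambda+g_\lambda)_\lambda]$ and $[\mathbf f]\le[\mathbf g]$ iff $\mathbf f\lesssim\mathbf g$; it is a Cu-semigroup. The endpoint map $\sigma_{S,T}\colon[\![S,T]\!]\to\mathrm{Cu}[S,T]$ is $\sigma_{S,T}([\mathbf f])(a)=\sup_\lambda f_\lambda(a)$. It is known that for Cu-semigroups $S,T,P$ the assignment sending $\alpha\in\mathrm{Cu}(S,[\![T,P]\!])$ to the Cu-morphism $a\otimes b\mapsto\sigma_{T,P}(\alpha(a))(b)$ in $\mathrm{Cu}(S\otimes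 T,P)$ is a bijection. The counit (evaluation) map $\mathrm e_{S,T}\colon[\![S,T]\!]\otimes S\to T$ is the Cu-morphism corresponding to $\mathrm{id}_{[\![S,T]\!]}$, and the unit map $\mathrm d_{S,T}\colon S\to[\![T,S\otimes T]\!]$ is the Cu-morphism corresponding to $\mathrm{id}_{S\otimes T}$. For a Cu-morphism $g\colon X\to Y$ and a Cu-semigroup $T$, $g_*\colon[\![T,X]\!]\to[\![T,Y]\!]$ is the Cu-morphism $[(f_\lambda)_\lambda]\mapsto[(g\circ f_\lambda)_\lambda]$. *)

theory Defs
  imports Complex_Main "HOL-Algebra.Group"
begin

section \<open>Cu-semigroups\<close>

record 'a pomonoid = "'a partial_object" +
  padd  :: "'a \<Rightarrow> 'a \<Rightarrow> 'a"     (infixl "\<oplus>\<index>" 65)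
  pzero :: "'a"               ("\<zero>\<index>")
  ple   :: "'a \<Rightarrow> 'a \<Rightarrow> bool"  (infix "\<preceq>\<index>" 50)

locale positively_ordered_semigroup =
  fixes S :: "'a pomonoid" (structure)
  assumes comm_monoid: "comm_monoid \<lparr>carrier = carrier S, mult = padd S, one = pzero S\<rparr>"
    and le_refl: "a \<in> carrier S \<Longrightarrow> a \<preceq> a"
    and le_antisym: "\<lbrakk>a \<in> carrier S; b \<in> carrier S; a \<preceq> b; b \<preceq> a\<rbrakk> \<Longrightarrow> a = b"
    and le_trans: "\<lbrakk>a \<in> carrier S; b \<in> carrier S; c \<in> carrier S; a \<preceq> b; b \<preceq> c\<rbrakk> \<Longrightarrow> a \<preceq> c"
    and add_mono: "\<lbrakk>a \<in> carrier S; b \<in> carrier S; c \<in> carrier S; a \<preceq> b\<rbrakk> \<Longrightarrow> a \<oplus> c \<preceq> b \<oplus> c"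
    and zero_le: "a \<in> carrier S \<Longrightarrow> \<zero> \<preceq> a"

definition is_sup :: "'a pomonoid \<Rightarrow> 'a set \<Rightarrow> 'a \<Rightarrow> bool" where
  "is_sup S A s \<longleftrightarrow> A \<subseteq> carrier S \<and> s \<in> carrier S \<and> (\<forall>x\<in>A. x \<preceq>\<^bsub>S\<^esub> s) \<and>
     (\<forall>u\<in>carrier S. (\<forall>x\<in>A. x \<preceq>\<^bsub>S\<^esub> u) \<longrightarrow> s \<preceq>\<^bsub>S\<^esub> u)"

definition the_sup :: "'a pomonoid \<Rightarrow> 'a set \<Rightarrow> 'a" where
  "the_sup S A = (THE s. is_sup S A s)"

definition increasing :: "'a pomonoid \<Rightarrow> (nat \<Rightarrow> 'a) \<Rightarrow> bool" where
  "increasing S c \<longleftrightarrow> (\<forall>n. c n \<in> carrier S) \<and> (\<forall>n. c n \<preceq>\<^bsub>S\<^esub> c (Suc n))"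

definition way_below :: "'a pomonoid \<Rightarrow> 'a \<Rightarrow> 'a \<Rightarrow> bool" (infix "\<lless>\<index>" 50) where
  "a \<lless>\<^bsub>S\<^esub> b \<longleftrightarrow> a \<in> carrier S \<and> b \<in> carrier S \<and>
     (\<forall>c s. increasing S c \<and> is_sup S (range c) s \<and> b \<preceq>\<^bsub>S\<^esub> s \<longrightarrow> (\<exists>k. a \<preceq>\<^bsub>S\<^esub> c k))"

locale cu_semigroup = positively_ordered_semigroup +
  assumes O1: "increasing S c \<Longrightarrow> \<exists>s. is_sup S (range c) s"
    and O2: "a \<in> carrier S \<Longrightarrow> \<exists>c. (\<forall>n. c n \<lless> c (Suc n)) \<and> is_sup S (range c) a"
    and O3: "\<lbrakk>a' \<lless> a; b' \<lless> b\<rbrakk> \<Longrightarrow> a' \<oplus> b' \<lless> a \<oplus> b"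
    and O4: "\<lbrakk>increasing S c; increasing S d; is_sup S (range c) x; is_sup S (range d) y\<rbrakk>
              \<Longrightarrow> is_sup S (range (\<lambda>n. c n \<oplus> d n)) (x \<oplus> y)"


section \<open>Morphisms and bimorphisms\<close>

text \<open>
  Maps between carriers are extensional (\<open>undefined\<close> outside the carrier), so that
  equality of morphisms is equality in HOL; composition is \<^const>\<open>compose\<close>.
\<close>

definition gen_cu_mor :: "'a pomonoid \<Rightarrow> 'b pomonoid \<Rightarrow> ('a \<Rightarrow> 'b) set" where
  "gen_cu_mor S T = {f \<in> carrier S \<rightarrow>\<^sub>E carrier T.
     (\<forall>a\<in>carrier S. \<forall>b\<in>carrier S. f (a \<oplus>\<^bsub>S\<^esub> b) = f a \<oplus>\<^bsub>T\<^esub> f b) \<and>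
     f \<zero>\<^bsub>S\<^esub> = \<zero>\<^bsub>T\<^esub> \<and>
     (\<forall>a\<in>carrier S. \<forall>b\<in>carrier S. a \<preceq>\<^bsub>S\<^esub> b \<longrightarrow> f a \<preceq>\<^bsub>T\<^esub> f b) \<and>
     (\<forall>c s. increasing S c \<and> is_sup S (range c) s \<longrightarrow> is_sup T (range (\<lambda>n. f (c n))) (f s))}"

definition cu_mor :: "'a pomonoid \<Rightarrow> 'b pomonoid \<Rightarrow> ('a \<Rightarrow> 'b) set" where
  "cu_mor S T = {f \<in> gen_cu_mor S T. \<forall>a' a. a' \<lless>\<^bsub>S\<^esub> a \<longrightarrow> f a' \<lless>\<^bsub>T\<^esub> f a}"

definition cu_id :: "'a pomonoid \<Rightarrow> 'a \<Rightarrow> 'a" where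
  "cu_id S = (\<lambda>a\<in>carrier S. a)"

definition cu_bimorphism ::
    "'a pomonoid \<Rightarrow> 'b pomonoid \<Rightarrow> 'p pomonoid \<Rightarrow> ('a \<Rightarrow> 'b \<Rightarrow> 'p) \<Rightarrow> bool" where
  "cu_bimorphism S T P \<phi> \<longleftrightarrow>
     (\<forall>a\<in>carrier S. \<forall>b\<in>carrier T. \<phi> a b \<in> carrier P) \<and>
     (\<forall>a\<in>carrier S. \<forall>a'\<in>carrier S. \<forall>b\<in>carrier T. \<phi> (a \<oplus>\<^bsub>S\<^esub> a') b = \<phi> a b \<oplus>\<^bsub>P\<^esub> \<phi> a' b) \<and>
     (\<forall>a\<in>carrier S. \<forall>b\<in>carrier T. \<forall>b'\<in>carrier T. \<phi> a (b \<oplus>\<^bsub>T\<^esub> b') = \<phi> a b \<oplus>\<^bsub>P\<^esub> \<phi> a b') \<and>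
     (\<forall>b\<in>carrier T. \<phi> \<zero>\<^bsub>S\<^esub> b = \<zero>\<^bsub>P\<^esub>) \<and>
     (\<forall>a\<in>carrier S. \<phi> a \<zero>\<^bsub>T\<^esub> = \<zero>\<^bsub>P\<^esub>) \<and>
     (\<forall>a\<in>carrier S. \<forall>a'\<in>carrier S. \<forall>b\<in>carrier T. a \<preceq>\<^bsub>S\<^esub> a' \<longrightarrow> \<phi> a b \<preceq>\<^bsub>P\<^esub> \<phi> a' b) \<and>
     (\<forall>a\<in>carrier S. \<forall>b\<in>carrier T. \<forall>b'\<in>carrier T. b \<preceq>\<^bsub>T\<^esub> b' \<longrightarrow> \<phi> a b \<preceq>\<^bsub>P\<^esub> \<phi> a b') \<and>
     (\<forall>c d x y. increasing S c \<and> increasing T d \<and> is_sup S (range c) x \<and> is_sup T (range d) y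
        \<longrightarrow> is_sup P (range (\<lambda>k. \<phi> (c k) (d k))) (\<phi> x y)) \<and>
     (\<forall>a' a b' b. a' \<lless>\<^bsub>S\<^esub> a \<and> b' \<lless>\<^bsub>T\<^esub> b \<longrightarrow> \<phi> a' b' \<lless>\<^bsub>P\<^esub> \<phi> a b)"


section \<open>Tensor products\<close>

text \<open>
  The tensor product is given by its universal property: \<open>X\<close> together with
  \<open>t a b\<close> (for \<open>a \<otimes> b\<close>) is a tensor product of \<open>S\<close> and \<open>T\<close>. As HOL does not
  quantify over types inside a formula, the target Cu-semigroups range over those
  with elements in a type \<open>'p\<close>, which is the last argument.
\<close>

definition is_cu_tensor ::
    "'a pomonoid \<Rightarrow> 'b pomonoid \<Rightarrow> 'x pomonoid \<Rightarrow> ('a \<Rightarrow> 'b \<Rightarrow> 'x) \<Rightarrow> 'p itself \<Rightarrow> bool" where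
  "is_cu_tensor S T X t (_ :: 'p itself) \<longleftrightarrow>
     cu_semigroup X \<and> cu_bimorphism S T X t \<and>
     (\<forall>P :: 'p pomonoid. cu_semigroup P \<longrightarrow>
        (\<forall>\<phi>. cu_bimorphism S T P \<phi> \<longrightarrow>
           (\<exists>!\<alpha>. \<alpha> \<in> cu_mor X P \<and> (\<forall>a\<in>carrier S. \<forall>b\<in>carrier T. \<alpha> (t a b) = \<phi> a b))) \<and>
        (\<forall>\<alpha>\<^sub>1\<in>cu_mor X P. \<forall>\<alpha>\<^sub>2\<in>cu_mor X P.
           (\<forall>x\<in>carrier X. \<alpha>\<^sub>1 x \<preceq>\<^bsub>P\<^esub> \<alpha>\<^sub>2 x) \<longleftrightarrow>
           (\<forall>a\<in>carrier S. \<forall>b\<in>carrier T. \<alpha>\<^sub>1 (t a b) \<preceq>\<^bsub>P\<^esub> \<alpha>\<^sub>2 (t a b))))"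

text \<open>\<open>\<phi>\<^sub>1 \<otimes> \<phi>\<^sub>2\<close> from the tensor product \<open>(X, t)\<close> of \<open>S\<close> and \<open>T\<close> to the tensor product \<open>(Y, u)\<close>.\<close>

definition tensor_map ::
    "'a pomonoid \<Rightarrow> 'b pomonoid \<Rightarrow> 'x pomonoid \<Rightarrow> ('a \<Rightarrow> 'b \<Rightarrow> 'x) \<Rightarrow>
     'y pomonoid \<Rightarrow> ('c \<Rightarrow> 'd \<Rightarrow> 'y) \<Rightarrow> ('a \<Rightarrow> 'c) \<Rightarrow> ('b \<Rightarrow> 'd) \<Rightarrow> 'x \<Rightarrow> 'y" where
  "tensor_map S T X t Y u \<phi>\<^sub>1 \<phi>\<^sub>2 =
     (THE \<gamma>. \<gamma> \<in> cu_mor X Y \<and>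
        (\<forall>a\<in>carrier S. \<forall>b\<in>carrier T. \<gamma> (t a b) = u (\<phi>\<^sub>1 a) (\<phi>\<^sub>2 b)))"


section \<open>The internal hom\<close>

abbreviation I_Q :: "rat set" where
  "I_Q \<equiv> {0<..<1}"

definition mor_prec :: "'a pomonoid \<Rightarrow> 'b pomonoid \<Rightarrow> ('a \<Rightarrow> 'b) \<Rightarrow> ('a \<Rightarrow> 'b) \<Rightarrow> bool" where
  "mor_prec S T \<phi> \<psi> \<longleftrightarrow> (\<forall>a' a. a' \<lless>\<^bsub>S\<^esub> a \<longrightarrow> \<phi> a' \<lless>\<^bsub>T\<^esub> \<psi> a)"

definition cu_paths :: "'a pomonoid \<Rightarrow> 'b pomonoid \<Rightarrow> (rat \<Rightarrow> 'a \<Rightarrow> 'b) set" where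
  "cu_paths S T = {f \<in> I_Q \<rightarrow>\<^sub>E gen_cu_mor S T.
     \<forall>l'\<in>I_Q. \<forall>l\<in>I_Q. l' < l \<longrightarrow> mor_prec S T (f l') (f l)}"

definition path_le ::
    "'a pomonoid \<Rightarrow> 'b pomonoid \<Rightarrow> (rat \<Rightarrow> 'a \<Rightarrow> 'b) \<Rightarrow> (rat \<Rightarrow> 'a \<Rightarrow> 'b) \<Rightarrow> bool" where
  "path_le S T f g \<longleftrightarrow> (\<forall>l\<in>I_Q. \<exists>m\<in>I_Q. mor_prec S T (f l) (g m))"

definition path_rel ::
    "'a pomonoid \<Rightarrow> 'b pomonoid \<Rightarrow> ((rat \<Rightarrow> 'a \<Rightarrow> 'b) \<times> (rat \<Rightarrow> 'a \<Rightarrow> 'b)) set" where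
  "path_rel S T =
     {(f, g). f \<in> cu_paths S T \<and> g \<in> cu_paths S T \<and> path_le S T f g \<and> path_le S T g f}"

definition path_class ::
    "'a pomonoid \<Rightarrow> 'b pomonoid \<Rightarrow> (rat \<Rightarrow> 'a \<Rightarrow> 'b) \<Rightarrow> (rat \<Rightarrow> 'a \<Rightarrow> 'b) set" where
  "path_class S T f = path_rel S T `` {f}"

definition path_add ::
    "'a pomonoid \<Rightarrow> 'b pomonoid \<Rightarrow> (rat \<Rightarrow> 'a \<Rightarrow> 'b) \<Rightarrow> (rat \<Rightarrow> 'a \<Rightarrow> 'b) \<Rightarrow> rat \<Rightarrow> 'a \<Rightarrow> 'b" where
  "path_add S T f g = (\<lambda>l\<in>I_Q. \<lambda>a\<in>carrier S. f l a \<oplus>\<^bsub>T\<^esub> g l a)"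

text \<open>
  Operations on classes are lifted as in the theory of equivalence relations: the
  unions below consist of a single class repeated.
\<close>

definition ihom :: "'a pomonoid \<Rightarrow> 'b pomonoid \<Rightarrow> (rat \<Rightarrow> 'a \<Rightarrow> 'b) set pomonoid" where
  "ihom S T = \<lparr>
     carrier = cu_paths S T // path_rel S T,
     padd = (\<lambda>F G. \<Union>f\<in>F. \<Union>g\<in>G. path_class S T (path_add S T f g)),
     pzero = path_class S T (\<lambda>l\<in>I_Q. \<lambda>a\<in>carrier S. \<zero>\<^bsub>T\<^esub>),
     ple = (\<lambda>F G. \<exists>f\<in>F. \<exists>g\<in>G. path_le S T f g)\<rparr>"

definition path_endpoint ::
    "'a pomonoid \<Rightarrow> 'b pomonoid \<Rightarrow> (rat \<Rightarrow> 'a \<Rightarrow> 'b) \<Rightarrow> 'a \<Rightarrow> 'b" where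
  "path_endpoint S T f = (\<lambda>a\<in>carrier S. the_sup T ((\<lambda>l. f l a) ` I_Q))"

definition endpoint :: "'a pomonoid \<Rightarrow> 'b pomonoid \<Rightarrow> (rat \<Rightarrow> 'a \<Rightarrow> 'b) set \<Rightarrow> 'a \<Rightarrow> 'b" where
  "endpoint S T F = the_elem (path_endpoint S T ` F)"

text \<open>The induced map \<open>g\<^sub>*\<close> from \<open>ihom T X\<close> to \<open>ihom T Y\<close>.\<close>

definition ihom_push ::
    "'b pomonoid \<Rightarrow> 'x pomonoid \<Rightarrow> 'y pomonoid \<Rightarrow> ('x \<Rightarrow> 'y) \<Rightarrow>
     (rat \<Rightarrow> 'b \<Rightarrow> 'x) set \<Rightarrow> (rat \<Rightarrow> 'b \<Rightarrow> 'y) set" where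
  "ihom_push T X Y g = (\<lambda>F\<in>carrier (ihom T X).
     \<Union>f\<in>F. path_class T Y (\<lambda>l\<in>I_Q. compose (carrier T) g (f l)))"


section \<open>The adjunction, its counit and its unit\<close>

text \<open>
  \<open>adj S T P X t\<close> maps Cu-morphisms from \<open>S\<close> to \<open>ihom T P\<close> to Cu-morphisms from the
  tensor product \<open>(X, t)\<close> of \<open>S\<close> and \<open>T\<close> to \<open>P\<close>.
\<close>

definition adj ::
    "'a pomonoid \<Rightarrow> 'b pomonoid \<Rightarrow> 'p pomonoid \<Rightarrow> 'x pomonoid \<Rightarrow> ('a \<Rightarrow> 'b \<Rightarrow> 'x) \<Rightarrow>
     ('a \<Rightarrow> (rat \<Rightarrow> 'b \<Rightarrow> 'p) set) \<Rightarrow> 'x \<Rightarrow> 'p" where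
  "adj S T P X t \<alpha> =
     (THE \<gamma>. \<gamma> \<in> cu_mor X P \<and>
        (\<forall>a\<in>carrier S. \<forall>b\<in>carrier T. \<gamma> (t a b) = endpoint T P (\<alpha> a) b))"

definition adj_inv ::
    "'a pomonoid \<Rightarrow> 'b pomonoid \<Rightarrow> 'p pomonoid \<Rightarrow> 'x pomonoid \<Rightarrow> ('a \<Rightarrow> 'b \<Rightarrow> 'x) \<Rightarrow>
     ('x \<Rightarrow> 'p) \<Rightarrow> 'a \<Rightarrow> (rat \<Rightarrow> 'b \<Rightarrow> 'p) set" where
  "adj_inv S T P X t = the_inv_into (cu_mor S (ihom T P)) (adj S T P X t)"

text \<open>\<open>(Y, u)\<close> is a tensor product of \<open>ihom T P\<close> and \<open>T\<close>.\<close>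

definition adj_counit ::
    "'b pomonoid \<Rightarrow> 'p pomonoid \<Rightarrow> 'y pomonoid \<Rightarrow>
     ((rat \<Rightarrow> 'b \<Rightarrow> 'p) set \<Rightarrow> 'b \<Rightarrow> 'y) \<Rightarrow> 'y \<Rightarrow> 'p" where
  "adj_counit T P Y u = adj (ihom T P) T P Y u (cu_id (ihom T P))"

text \<open>\<open>(X, t)\<close> is a tensor product of \<open>S\<close> and \<open>T\<close>.\<close>

definition adj_unit ::
    "'a pomonoid \<Rightarrow> 'b pomonoid \<Rightarrow> 'x pomonoid \<Rightarrow> ('a \<Rightarrow> 'b \<Rightarrow> 'x) \<Rightarrow>
     'a \<Rightarrow> (rat \<Rightarrow> 'b \<Rightarrow> 'x) set" where
  "adj_unit S T X t = adj_inv S T X X t (cu_id X)"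

end

theory Submission
  imports Defs "HOL-Library.Countable"
begin

text \<open>
  By the universal property of the tensor product it suffices to identify Cu-morphisms
  \<open>S \<rightarrow> ihom T P\<close> with Cu-bimorphisms \<open>S \<times> T \<rightarrow> P\<close>. The endpoint map is itself a Cu-bimorphism
  \<open>ihom T P \<times> T \<rightarrow> P\<close>, so composing with it gives one direction. For the other, choose a
  \<open>\<lless>\<close>-increasing path \<open>p\<close> in \<open>S\<close> with supremum \<open>a\<close> and send \<open>a\<close> to the class of
  \<open>\<lambda>l. \<phi>(p l, \<cdot>)\<close>. Two facts about \<open>ihom\<close> carry the argument: if \<open>[h]\<close> is the supremum
  of \<open>[f\<^sub>n]\<close>, then each \<open>h\<^sub>l\<close> is \<open>\<prec>\<close>-below a term of some \<open>f\<^sub>n\<close>, and \<open>[f] \<lless> [g]\<close> holds iff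
  one single \<open>g\<^sub>l\<close> bounds all of \<open>f\<close>. The formulas with unit and counit then follow by
  evaluating both sides on elementary tensors.
\<close>

section \<open>Order and way-below\<close>

text \<open>Sequences and rational paths must be exchanged in both directions: (O1), (O2) and
  \<open>\<lless>\<close> speak of sequences, \<open>ihom\<close> of paths. A path becomes a
  sequence by restriction to the cofinal \<open>I_Q_seq\<close>. A sequence becomes a path by
  filling in a chain of order type omega, one rational at a time; this needs a transitive and
  interpolative relation, which \<open>\<lless>\<close> is, whereas \<open>mor_prec\<close> need not
  interpolate. The delicate point of the bijection is injectivity, because the endpoint map itself
  is not injective: on [0,\<infinity>] the constant path at the identity and the path of the maps b
  \<mapsto> l * b have the same endpoint but different classes. A single value \<alpha> a can
  therefore not be recovered from its endpoint. For a whole Cu-morphism \<alpha> it can: a is a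
  supremum of elements way below it, \<alpha> preserves \<open>\<lless>\<close> and suprema, and
  endpoints do decide the order once there is room on both sides.\<close>

lemma increasing_closed: "increasing S c \<Longrightarrow> c n \<in> carrier S"
  by (simp add: increasing_def)

lemma is_sup_closed: "is_sup S A s \<Longrightarrow> s \<in> carrier S"
  by (simp add: is_sup_def)

lemma is_sup_upper: "is_sup S A s \<Longrightarrow> x \<in> A \<Longrightarrow> x \<preceq>\<^bsub>S\<^esub> s"
  by (simp add: is_sup_def)

lemma is_sup_least:
  "is_sup S A s \<Longrightarrow> u \<in> carrier S \<Longrightarrow> (\<And>x. x \<in> A \<Longrightarrow> x \<preceq>\<^bsub>S\<^esub> u) \<Longrightarrow> s \<preceq>\<^bsub>S\<^esub> u"
  by (simp add: is_sup_def)

lemma way_below_closed: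
  "a \<lless>\<^bsub>S\<^esub> b \<Longrightarrow> a \<in> carrier S" "a \<lless>\<^bsub>S\<^esub> b \<Longrightarrow> b \<in> carrier S"
  by (simp_all add: way_below_def)

lemma way_belowD:
  "\<lbrakk>a \<lless>\<^bsub>S\<^esub> b; increasing S c; is_sup S (range c) s; b \<preceq>\<^bsub>S\<^esub> s\<rbrakk> \<Longrightarrow> \<exists>k. a \<preceq>\<^bsub>S\<^esub> c k"
  by (auto simp: way_below_def)

context positively_ordered_semigroup
begin

lemma zero_closed: "\<zero> \<in> carrier S"
  using monoid.one_closed[OF comm_monoid.axioms(1)[OF comm_monoid]] by simp

lemma add_closed: "a \<in> carrier S \<Longrightarrow> b \<in> carrier S \<Longrightarrow> a \<oplus> b \<in> carrier S"
  using monoid.m_closed[OF comm_monoid.axioms(1)[OF comm_monoid]] by simp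

lemma add_commute: "a \<in> carrier S \<Longrightarrow> b \<in> carrier S \<Longrightarrow> a \<oplus> b = b \<oplus> a"
  using comm_monoid.m_comm[OF comm_monoid] by simp

lemma add_assoc:
  "a \<in> carrier S \<Longrightarrow> b \<in> carrier S \<Longrightarrow> c \<in> carrier S \<Longrightarrow> a \<oplus> b \<oplus> c = a \<oplus> (b \<oplus> c)"
  using monoid.m_assoc[OF comm_monoid.axioms(1)[OF comm_monoid]] by simp

lemma add_zero: "a \<in> carrier S \<Longrightarrow> a \<oplus> \<zero> = a"
  using monoid.r_one[OF comm_monoid.axioms(1)[OF comm_monoid]] by simp

lemma add_interchange:
  assumes "a \<in> carrier S" "b \<in> carrier S" "c \<in> carrier S" "d \<in> carrier S"
  shows "(a \<oplus> b) \<oplus> (c \<oplus> d) = (a \<oplus> c) \<oplus> (b \<oplus> d)"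
  using assms by (metis add_assoc add_commute add_closed)

lemma add_mono2:
  assumes "a \<in> carrier S" "b \<in> carrier S" "c \<in> carrier S" "d \<in> carrier S" "a \<preceq> b" "c \<preceq> d"
  shows "a \<oplus> c \<preceq> b \<oplus> d"
  using assms by (metis add_mono add_commute add_closed le_trans)

lemma is_sup_unique: "is_sup S A s \<Longrightarrow> is_sup S A s' \<Longrightarrow> s = s'"
  by (meson is_sup_def le_antisym)

lemma the_sup_eq: "is_sup S A s \<Longrightarrow> the_sup S A = s"
  unfolding the_sup_def by (blast intro: is_sup_unique)

lemma increasing_le: "increasing S c \<Longrightarrow> m \<le> n \<Longrightarrow> c m \<preceq> c n"
proof (induction n)
  case 0
  then show ?case by (auto simp: increasing_def intro: le_refl)
next
  case (Suc n)
  then show ?case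
    by (metis increasing_def le_Suc_eq le_refl le_trans)
qed

lemma increasing_const: "a \<in> carrier S \<Longrightarrow> increasing S (\<lambda>_. a)"
  by (simp add: increasing_def le_refl)

lemma is_sup_const: "a \<in> carrier S \<Longrightarrow> is_sup S (range (\<lambda>_::nat. a)) a"
  by (auto simp: is_sup_def le_refl)

lemma way_below_le: "a \<lless> b \<Longrightarrow> a \<preceq> b"
  using way_belowD[OF _ increasing_const is_sup_const] way_below_closed le_refl by metis

lemma le_way_below:
  assumes "a \<preceq> b" "b \<lless> c" "a \<in> carrier S"
  shows "a \<lless> c"
  using assms unfolding way_below_def by (meson increasing_closed le_trans)

lemma way_below_le_trans:
  assumes "a \<lless> b" "b \<preceq> c" "c \<in> carrier S"
  shows "a \<lless> c"
  using assms unfolding way_below_def by (meson is_sup_closed le_trans)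

lemma way_below_trans: "a \<lless> b \<Longrightarrow> b \<lless> c \<Longrightarrow> a \<lless> c"
  by (meson way_below_le le_way_below way_below_closed)

text \<open>Used to pass between the supremum of a sequence and that of a family indexed by
  rationals.\<close>

lemma is_sup_range_cofinal:
  assumes "is_sup S A s" "B \<subseteq> carrier S" "\<And>x. x \<in> A \<Longrightarrow> \<exists>y\<in>B. x \<preceq> y" "\<And>y. y \<in> B \<Longrightarrow> \<exists>x\<in>A. y \<preceq> x"
  shows "is_sup S B s"
  using assms unfolding is_sup_def by (meson le_trans subsetD)

end

context cu_semigroup
begin

lemma way_below_chain:
  assumes "a \<in> carrier S"
  obtains c where "\<And>n. c n \<lless> c (Suc n)" "is_sup S (range c) a" "increasing S c" "\<And>n. c n \<lless> a"
proof -
  obtain c where c: "\<forall>n. c n \<lless> c (Suc n)" "is_sup S (range c) a"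
    using O2[OF assms] by blast
  have "increasing S c"
    using c(1) by (auto simp: increasing_def intro: way_below_closed(1) way_below_le)
  moreover have "c n \<lless> a" for n
    using way_below_le_trans[OF c(1)[rule_format, of n] is_sup_upper[OF c(2)] assms] by simp
  ultimately show thesis using that c by blast
qed

text \<open>An approximating chain for b from (O2) overtakes a at some index, and its next term is
  then strictly way above a.\<close>

lemma way_below_interpolate:
  assumes "a \<lless> b"
  obtains c where "a \<lless> c" "c \<lless> b"
proof -
  obtain d where d: "\<And>n. d n \<lless> d (Suc n)" "is_sup S (range d) b" "increasing S d" "\<And>n. d n \<lless> b"
    using way_below_chain way_below_closed(2)[OF assms] by blast
  obtain k where "a \<preceq> d k"
    using way_belowD[OF assms d(3,2)] le_refl way_below_closed(2)[OF assms] by blast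
  then have "a \<lless> d (Suc k)" using d(1) le_way_below way_below_closed(1)[OF assms] by blast
  then show thesis using d(4) that by blast
qed

end

section \<open>Chains indexed by rationals\<close>

text \<open>One extension step in the style of Cantor: initial segments of A are finite, so q has an
  immediate predecessor and an immediate successor in A, and by transitivity a value interpolated
  between these two fits all of A.\<close>

lemma rat_chain_extend:
  fixes A :: "rat set" and h :: "rat \<Rightarrow> 'd" and q a0 b0 :: rat
  assumes tr: "transp R"
    and interp: "\<forall>x y. R x y \<longrightarrow> (\<exists>z. R x z \<and> R z y)"
    and fin: "\<forall>r. finite {a\<in>A. a \<le> r}"
    and a0: "a0 \<in> A" "a0 < q" and b0: "b0 \<in> A" "q < b0"
    and mono: "\<forall>a\<in>A. \<forall>b\<in>A. a < b \<longrightarrow> R (h a) (h b)"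
  shows "\<exists>z. (\<forall>a\<in>A. a < q \<longrightarrow> R (h a) z) \<and> (\<forall>b\<in>A. q < b \<longrightarrow> R z (h b))"
proof -
  define L where "L = {a\<in>A. a < q}"
  \<comment> \<open>A itself may be unbounded; cutting at \<open>b0\<close> makes the set finite
    without changing its minimum.\<close>
  define U where "U = {b\<in>A. q < b \<and> b \<le> b0}"
  have L: "finite L" "L \<noteq> {}" using a0 by (auto simp: L_def intro: finite_subset[OF _ fin[rule_format, of q]])
  have U: "finite U" "U \<noteq> {}" using b0 by (auto simp: U_def intro: finite_subset[OF _ fin[rule_format, of b0]])
  have m: "Max L \<in> A" "Max L < q" "Min U \<in> A" "q < Min U" "Min U \<le> b0"
    using Max_in[OF L] Min_in[OF U] by (auto simp: L_def U_def)
  obtain z where z: "R (h (Max L)) z" "R z (h (Min U))"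
    using interp mono m by (meson less_trans)
  have "R (h a) z" if "a \<in> A" "a < q" for a
  proof -
    have "a \<le> Max L" using that L by (simp add: L_def)
    then show ?thesis using z(1) mono that(1) m(1) transpD[OF tr] by (metis order_le_less)
  qed
  moreover have "R z (h b)" if "b \<in> A" "q < b" for b
  proof -
    have "Min U \<le> b" using that U m(5) by (cases "b \<le> b0") (auto simp: U_def)
    then show ?thesis using z(2) mono m(3) that(1) transpD[OF tr] by (metis order_le_less)
  qed
  ultimately show ?thesis by blast
qed

text \<open>The values at the naturals are prescribed by x; the remaining nonnegative rationals are
  added one by one along the enumeration \<open>to_nat\<close>.\<close>

lemma nonneg_rat_chain:
  fixes x :: "nat \<Rightarrow> 'd"
  assumes tr: "transp R"
    and interp: "\<forall>x y. R x y \<longrightarrow> (\<exists>z. R x z \<and> R z y)"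
    and x: "\<forall>n. R (x n) (x (Suc n))"
  shows "\<exists>h :: rat \<Rightarrow> 'd. (\<forall>a b. 0 \<le> a \<longrightarrow> a < b \<longrightarrow> R (h a) (h b)) \<and> (\<forall>n. h (of_nat n) = x n)"
proof -
  \<comment> \<open>The domain on which stage n is already required to be monotone. It contains all
    naturals from the start, so every positive rational always has neighbours on both sides.\<close>
  define E :: "nat \<Rightarrow> rat set" where "E n = \<nat> \<union> {q::rat. 0 \<le> q \<and> to_nat q < n}" for n
  define good where "good n h \<longleftrightarrow> (\<forall>a\<in>E n. \<forall>b\<in>E n. a < b \<longrightarrow> R (h a) (h b)) \<and> (\<forall>k. h (of_nat k) = x k)"
    for n :: nat and h :: "rat \<Rightarrow> 'd"
  have xmono: "R (x m) (x n)" if "m < n" for m n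
    using that
  proof (induction n)
    case (Suc n)
    then show ?case using transpD[OF tr _ x[rule_format, of n]] x by (auto simp: less_Suc_eq)
  qed simp
  have fin: "\<forall>r. finite {a\<in>E n. a \<le> r}" for n
  proof
    fix r :: rat
    have "{a\<in>E n. a \<le> r} \<subseteq> of_nat ` {..nat \<lfloor>r\<rfloor>} \<union> from_nat ` {..<n}"
    proof
      fix a assume "a \<in> {a\<in>E n. a \<le> r}"
      then consider k where "a = of_nat k" "of_nat k \<le> r" | "to_nat a < n"
        by (auto simp: E_def Nats_def)
      then show "a \<in> of_nat ` {..nat \<lfloor>r\<rfloor>} \<union> from_nat ` {..<n}"
      proof cases
        case 1
        then have "k \<le> nat \<lfloor>r\<rfloor>" by (simp add: le_nat_iff le_floor_iff)
        then show ?thesis using 1 by blast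
      next
        case 2
        then show ?thesis by (metis UnI2 from_nat_to_nat image_eqI lessThan_iff)
      qed
    qed
    then show "finite {a\<in>E n. a \<le> r}"
      by (rule finite_subset) simp
  qed
  have "\<exists>f. \<forall>n. good n (f n) \<and> (\<forall>a\<in>E n. f (Suc n) a = f n a)"
  proof (rule dependent_nat_choice)
    \<comment> \<open>The floor only makes x a total function; values off the naturals are
      overwritten or ignored later.\<close>
    have "good 0 (\<lambda>q. x (nat \<lfloor>q\<rfloor>))"
      by (auto simp: good_def E_def Nats_def xmono)
    then show "\<exists>h. good 0 h" by blast
  next
    fix h n assume h: "good n h"
    define q :: rat where "q = from_nat n"
    have "E (Suc n) \<subseteq> insert q (E n)"
      by (auto simp: E_def q_def less_Suc_eq)
    show "\<exists>h'. good (Suc n) h' \<and> (\<forall>a\<in>E n. h' a = h a)"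
    \<comment> \<open>Nothing has to be done if n codes a natural or a negative number, or is no
      code at all. Otherwise q is new, positive and not a natural, so updating at q leaves the
      prescribed values intact.\<close>
    proof (cases "E (Suc n) = E n")
      case True
      then show ?thesis using h by (auto simp: good_def)
    next
      case False
      then have q: "q \<in> E (Suc n)" "q \<notin> E n" "E (Suc n) = insert q (E n)"
        using \<open>E (Suc n) \<subseteq> insert q (E n)\<close> by (auto simp: E_def)
      then have "q \<ge> 0" "q \<notin> \<nat>" by (auto simp: E_def Nats_def)
      then have "0 < q" by (metis Nats_0 order_le_less)
      have b0: "of_nat (nat \<lceil>q\<rceil> + 1) \<in> E n" "q < of_nat (nat \<lceil>q\<rceil> + 1)"
        by (auto simp: E_def) linarith
      have "0 \<in> E n" by (simp add: E_def)
      obtain z where z: "\<forall>a\<in>E n. a < q \<longrightarrow> R (h a) z" "\<forall>b\<in>E n. q < b \<longrightarrow> R z (h b)"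
        using rat_chain_extend[of R "E n" 0 q _ h, OF tr interp fin \<open>0 \<in> E n\<close> \<open>0 < q\<close> b0] h
        unfolding good_def by blast
      have "good (Suc n) (h(q := z))"
        using h z q \<open>q \<notin> \<nat>\<close> by (auto simp: good_def)
      then show ?thesis using q(2) by (intro exI[of _ "h(q := z)"]) auto
    qed
  qed
  then obtain f where f: "\<And>n. good n (f n)" "\<And>n a. a \<in> E n \<Longrightarrow> f (Suc n) a = f n a" by blast
  have E_mono: "E m \<subseteq> E n" if "m \<le> n" for m n using that by (auto simp: E_def)
  have stable: "f n a = f m a" if "a \<in> E m" "m \<le> n" for m n a
    using that(2)
  proof (induction n rule: dec_induct)
    case (step n)
    then show ?case using f(2) E_mono that(1) by (metis subsetD)
  qed simp
  \<comment> \<open>The value at a no longer changes from the first stage whose domain is sure to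
    contain a.\<close>
  define h where "h a = f (Suc (to_nat a)) a" for a
  have inE: "a \<in> E (Suc (to_nat a))" if "0 \<le> a" for a using that by (simp add: E_def)
  have "R (h a) (h b)" if "0 \<le> a" "a < b" for a b
  proof -
    define N where "N = max (Suc (to_nat a)) (Suc (to_nat b))"
    have "a \<in> E N" "b \<in> E N" using inE E_mono that by (auto simp: N_def E_def)
    moreover have "h a = f N a" "h b = f N b"
      using stable[OF inE, of a N] stable[OF inE, of b N] that by (simp_all add: N_def h_def)
    ultimately show ?thesis using f(1) that(2) by (auto simp: good_def)
  qed
  moreover have "h (of_nat n) = x n" for n using f(1) by (auto simp: h_def good_def)
  ultimately show ?thesis by blast
qed

text \<open>Reparametrisation of the previous chain. The last two conclusions say that h and x are
  mutually cofinal, which is what carries suprema over from the sequence to the path.\<close>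

lemma I_Q_chain:
  fixes x :: "nat \<Rightarrow> 'd"
  assumes tr: "transp R"
    and interp: "\<forall>x y. R x y \<longrightarrow> (\<exists>z. R x z \<and> R z y)"
    and x: "\<forall>n. R (x n) (x (Suc n))"
  obtains h :: "rat \<Rightarrow> 'd" where "\<And>a b. a \<in> I_Q \<Longrightarrow> b \<in> I_Q \<Longrightarrow> a < b \<Longrightarrow> R (h a) (h b)"
    "\<And>a. a \<in> I_Q \<Longrightarrow> \<exists>n. R (h a) (x n)" "\<And>n. \<exists>a\<in>I_Q. R (x n) (h a)"
proof -
  obtain h :: "rat \<Rightarrow> 'd"
    where h: "\<And>a b. 0 \<le> a \<Longrightarrow> a < b \<Longrightarrow> R (h a) (h b)" "\<And>n. h (of_nat n) = x n"
    using nonneg_rat_chain[OF tr interp x] by blast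
  \<comment> \<open>a \<mapsto> 1/(1 - a) is an order isomorphism of (0,1) onto the rationals above
    1.\<close>
  define k where "k a = h (1 / (1 - a))" for a
  show thesis
  proof (rule that[of k])
    fix a b :: rat assume "a \<in> I_Q" "b \<in> I_Q" "a < b"
    then show "R (k a) (k b)" unfolding k_def by (intro h(1)) (auto simp: field_simps)
  next
    fix a :: rat assume "a \<in> I_Q"
    then have "0 \<le> 1 / (1 - a)" by simp
    moreover obtain n :: nat where "1 / (1 - a) < of_nat n" using reals_Archimedean2 by blast
    ultimately show "\<exists>n. R (k a) (x n)" unfolding k_def by (metis h)
  next
    fix n
    \<comment> \<open>Chosen so that 1/(1 - a) = n + 2 exceeds n; the shift by 2 instead of 1 keeps
      a positive at n = 0.\<close>
    define a :: rat where "a = 1 - 1 / (of_nat n + 2)"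
    have "a \<in> I_Q" "1 / (1 - a) = of_nat (n + 2)" by (auto simp: a_def field_simps)
    then show "\<exists>a\<in>I_Q. R (x n) (k a)"
      using h(1)[of "of_nat n" "of_nat (n + 2)"] h(2) unfolding k_def
      by (metis less_add_same_cancel1 of_nat_0_le_iff of_nat_less_iff zero_less_numeral)
  qed
qed

section \<open>Generalized Cu-morphisms and paths\<close>

lemma gen_cu_mor_closed: "f \<in> gen_cu_mor S T \<Longrightarrow> a \<in> carrier S \<Longrightarrow> f a \<in> carrier T"
  by (auto simp: gen_cu_mor_def)

lemma gen_cu_mor_add:
  "\<lbrakk>f \<in> gen_cu_mor S T; a \<in> carrier S; b \<in> carrier S\<rbrakk> \<Longrightarrow> f (a \<oplus>\<^bsub>S\<^esub> b) = f a \<oplus>\<^bsub>T\<^esub> f b"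
  by (auto simp: gen_cu_mor_def)

lemma gen_cu_mor_zero: "f \<in> gen_cu_mor S T \<Longrightarrow> f \<zero>\<^bsub>S\<^esub> = \<zero>\<^bsub>T\<^esub>"
  by (auto simp: gen_cu_mor_def)

lemma gen_cu_mor_mono:
  "\<lbrakk>f \<in> gen_cu_mor S T; a \<in> carrier S; b \<in> carrier S; a \<preceq>\<^bsub>S\<^esub> b\<rbrakk> \<Longrightarrow> f a \<preceq>\<^bsub>T\<^esub> f b"
  by (auto simp: gen_cu_mor_def)

lemma gen_cu_mor_sup:
  "\<lbrakk>f \<in> gen_cu_mor S T; increasing S c; is_sup S (range c) s\<rbrakk> \<Longrightarrow> is_sup T (range (\<lambda>n. f (c n))) (f s)"
  by (auto simp: gen_cu_mor_def)

lemma gen_cu_mor_increasing: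
  "f \<in> gen_cu_mor S T \<Longrightarrow> increasing S c \<Longrightarrow> increasing T (\<lambda>n. f (c n))"
  by (auto simp: increasing_def gen_cu_mor_closed gen_cu_mor_mono)

lemma cu_mor_gen: "f \<in> cu_mor S T \<Longrightarrow> f \<in> gen_cu_mor S T"
  by (simp add: cu_mor_def)

lemma cu_mor_way_below: "f \<in> cu_mor S T \<Longrightarrow> a \<lless>\<^bsub>S\<^esub> b \<Longrightarrow> f a \<lless>\<^bsub>T\<^esub> f b"
  by (simp add: cu_mor_def)

lemma cu_mor_extensional: "f \<in> cu_mor S T \<Longrightarrow> f \<in> extensional (carrier S)"
  by (auto simp: cu_mor_def gen_cu_mor_def PiE_def)

lemma gen_cu_mor_compose:
  assumes f: "f \<in> gen_cu_mor A B" and g: "g \<in> gen_cu_mor B C" and A: "positively_ordered_semigroup A"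
  shows "compose (carrier A) g f \<in> gen_cu_mor A C"
proof -
  have sup: "is_sup C (range (\<lambda>n. compose (carrier A) g f (c n))) (compose (carrier A) g f s)"
    if c: "increasing A c" "is_sup A (range c) s" for c s
  proof -
    have "compose (carrier A) g f (c n) = g (f (c n))" for n
      using c(1) by (simp add: compose_def increasing_closed)
    moreover have "compose (carrier A) g f s = g (f s)"
      using c(2) by (simp add: compose_def is_sup_closed)
    ultimately show ?thesis
      using gen_cu_mor_sup[OF g gen_cu_mor_increasing[OF f c(1)] gen_cu_mor_sup[OF f c]] by simp
  qed
  show ?thesis
    unfolding gen_cu_mor_def
    using sup positively_ordered_semigroup.zero_closed[OF A] positively_ordered_semigroup.add_closed[OF A]
    by (auto simp: compose_def gen_cu_mor_closed[OF f] gen_cu_mor_closed[OF g]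
        gen_cu_mor_add[OF f] gen_cu_mor_add[OF g] gen_cu_mor_zero[OF f] gen_cu_mor_zero[OF g]
        intro!: gen_cu_mor_mono[OF g] gen_cu_mor_mono[OF f])
qed

lemma cu_mor_compose:
  assumes f: "f \<in> cu_mor A B" and g: "g \<in> cu_mor B C" and A: "positively_ordered_semigroup A"
  shows "compose (carrier A) g f \<in> cu_mor A C"
proof -
  have "compose (carrier A) g f a' \<lless>\<^bsub>C\<^esub> compose (carrier A) g f a" if "a' \<lless>\<^bsub>A\<^esub> a" for a' a
    using cu_mor_way_below[OF g cu_mor_way_below[OF f that]] way_below_closed[OF that]
    by (simp add: compose_def)
  then show ?thesis
    using gen_cu_mor_compose[OF cu_mor_gen[OF f] cu_mor_gen[OF g] A] by (simp add: cu_mor_def)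
qed

text \<open>Stated with bare closure hypotheses so that it applies to \<open>ihom\<close> as well,
  where the counit needs the identity.\<close>

lemma cu_id_mor:
  assumes "\<zero>\<^bsub>S\<^esub> \<in> carrier S"
    and "\<And>a b. a \<in> carrier S \<Longrightarrow> b \<in> carrier S \<Longrightarrow> a \<oplus>\<^bsub>S\<^esub> b \<in> carrier S"
  shows "cu_id S \<in> cu_mor S S"
proof -
  have "is_sup S (range (\<lambda>n. cu_id S (c n))) (cu_id S s)"
    if "increasing S c" "is_sup S (range c) s" for c s
    using that by (simp add: cu_id_def increasing_closed is_sup_closed)
  then show ?thesis
    using assms by (auto simp: cu_mor_def gen_cu_mor_def cu_id_def way_below_closed)
qed

lemma I_Q_dense:
  fixes l m :: rat
  assumes "l \<in> I_Q" "m \<in> I_Q" "l < m"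
  obtains k where "k \<in> I_Q" "l < k" "k < m"
  using dense[OF assms(3)] assms by (metis greaterThanLessThan_iff less_trans)

lemma I_Q_above:
  fixes l :: rat
  assumes "l \<in> I_Q"
  obtains m where "m \<in> I_Q" "l < m"
  using dense[of l 1] assms by (metis greaterThanLessThan_iff less_trans)

text \<open>Strictly increasing and cofinal in (0,1), this replaces suprema over \<open>I_Q\<close>
  by suprema of sequences, to which (O1) and (O4) apply.\<close>

definition I_Q_seq :: "nat \<Rightarrow> rat" where
  "I_Q_seq n = 1 - 1 / (of_nat n + 2)"

lemma I_Q_seq_in: "I_Q_seq n \<in> I_Q"
  by (auto simp: I_Q_seq_def field_simps)

lemma I_Q_seq_less: "m < n \<Longrightarrow> I_Q_seq m < I_Q_seq n"
  by (auto simp: I_Q_seq_def frac_less2)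

lemma I_Q_seq_cofinal:
  assumes "l < 1"
  obtains n where "l < I_Q_seq n"
proof -
  obtain n :: nat where n: "1 / (1 - l) < of_nat n" using reals_Archimedean2 by blast
  have "1 < (of_nat n + 2) * (1 - l)"
    using n assms by (simp add: field_simps)
  then have "l < I_Q_seq n"
    by (simp add: I_Q_seq_def field_simps)
  then show thesis by (rule that)
qed

section \<open>The relation \<open>mor_prec\<close>, paths, and suprema of increasing sequences of
  paths\<close>

locale cu_pair = T: cu_semigroup T + P: cu_semigroup P
  for T :: "'b pomonoid" and P :: "'p pomonoid"
begin

abbreviation prec :: "('b \<Rightarrow> 'p) \<Rightarrow> ('b \<Rightarrow> 'p) \<Rightarrow> bool" (infix "\<sqsubset>" 50) where
  "\<phi> \<sqsubset> \<psi> \<equiv> mor_prec T P \<phi> \<psi>"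

lemma precD: "\<phi> \<sqsubset> \<psi> \<Longrightarrow> a \<lless>\<^bsub>T\<^esub> b \<Longrightarrow> \<phi> a \<lless>\<^bsub>P\<^esub> \<psi> b"
  by (auto simp: mor_prec_def)

text \<open>Each hypothesis consumes one \<open>\<lless>\<close> in T, so the given pair is first
  split by an interpolant.\<close>

lemma prec_trans:
  assumes "\<phi> \<sqsubset> \<psi>" "\<psi> \<sqsubset> \<chi>"
  shows "\<phi> \<sqsubset> \<chi>"
  unfolding mor_prec_def
proof (intro allI impI)
  fix a' a assume "a' \<lless>\<^bsub>T\<^esub> a"
  then obtain b where "a' \<lless>\<^bsub>T\<^esub> b" "b \<lless>\<^bsub>T\<^esub> a" by (rule T.way_below_interpolate)
  then show "\<phi> a' \<lless>\<^bsub>P\<^esub> \<chi> a"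
    using precD assms by (meson P.way_below_trans)
qed

text \<open>\<open>mor_prec\<close> compares the value of \<phi> only at elements way below a; since
  a is the supremum of such elements and \<phi> preserves it, the comparison extends to a
  itself.\<close>

lemma prec_le:
  assumes "\<phi> \<sqsubset> \<psi>" "\<phi> \<in> gen_cu_mor T P" "\<psi> \<in> gen_cu_mor T P" "a \<in> carrier T"
  shows "\<phi> a \<preceq>\<^bsub>P\<^esub> \<psi> a"
proof -
  obtain c where c: "is_sup T (range c) a" "increasing T c" "\<And>n. c n \<lless>\<^bsub>T\<^esub> a"
    using T.way_below_chain[OF assms(4)] by metis
  have "\<phi> (c n) \<preceq>\<^bsub>P\<^esub> \<psi> a" for n
    using precD[OF assms(1) c(3)] P.way_below_le by blast
  then show ?thesis
    using is_sup_least[OF gen_cu_mor_sup[OF assms(2) c(2,1)] gen_cu_mor_closed[OF assms(3,4)]] by blast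
qed

lemma le_prec:
  assumes "\<And>a. a \<in> carrier T \<Longrightarrow> \<phi> a \<preceq>\<^bsub>P\<^esub> \<psi> a" "\<psi> \<sqsubset> \<chi>" "\<phi> \<in> gen_cu_mor T P"
  shows "\<phi> \<sqsubset> \<chi>"
  unfolding mor_prec_def
proof (intro allI impI)
  fix a' a assume a: "a' \<lless>\<^bsub>T\<^esub> a"
  show "\<phi> a' \<lless>\<^bsub>P\<^esub> \<chi> a"
    using P.le_way_below[OF assms(1) precD[OF assms(2) a] gen_cu_mor_closed[OF assms(3)]]
      way_below_closed[OF a] by blast
qed

lemma prec_le_trans:
  assumes "\<phi> \<sqsubset> \<psi>" "\<And>a. a \<in> carrier T \<Longrightarrow> \<psi> a \<preceq>\<^bsub>P\<^esub> \<chi> a" "\<chi> \<in> gen_cu_mor T P"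
  shows "\<phi> \<sqsubset> \<chi>"
  unfolding mor_prec_def
proof (intro allI impI)
  fix a' a assume a: "a' \<lless>\<^bsub>T\<^esub> a"
  show "\<phi> a' \<lless>\<^bsub>P\<^esub> \<chi> a"
    using P.way_below_le_trans[OF precD[OF assms(1) a] assms(2) gen_cu_mor_closed[OF assms(3)]]
      way_below_closed[OF a] by blast
qed

lemma path_gen: "f \<in> cu_paths T P \<Longrightarrow> l \<in> I_Q \<Longrightarrow> f l \<in> gen_cu_mor T P"
  by (auto simp: cu_paths_def)

lemma path_closed: "\<lbrakk>f \<in> cu_paths T P; l \<in> I_Q; a \<in> carrier T\<rbrakk> \<Longrightarrow> f l a \<in> carrier P"
  by (rule gen_cu_mor_closed[OF path_gen])

lemma path_prec: "\<lbrakk>f \<in> cu_paths T P; l \<in> I_Q; m \<in> I_Q; l < m\<rbrakk> \<Longrightarrow> f l \<sqsubset> f m"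
  by (auto simp: cu_paths_def)

lemma path_mono:
  assumes "f \<in> cu_paths T P" "l \<in> I_Q" "m \<in> I_Q" "l \<le> m" "a \<in> carrier T"
  shows "f l a \<preceq>\<^bsub>P\<^esub> f m a"
proof (cases "l = m")
  case True
  then show ?thesis using P.le_refl path_closed assms by simp
next
  case False
  then have "f l \<sqsubset> f m" using path_prec assms by simp
  then show ?thesis using prec_le path_gen assms by simp
qed

lemma prec_path_mono:
  "\<lbrakk>\<phi> \<sqsubset> f l; f \<in> cu_paths T P; l \<in> I_Q; m \<in> I_Q; l \<le> m\<rbrakk> \<Longrightarrow> \<phi> \<sqsubset> f m"
  using prec_le_trans path_mono path_gen by blast

lemma path_prec_mono:
  "\<lbrakk>f m \<sqsubset> \<phi>; f \<in> cu_paths T P; l \<in> I_Q; m \<in> I_Q; l \<le> m\<rbrakk> \<Longrightarrow> f l \<sqsubset> \<phi>"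
  using le_prec path_mono path_gen by blast

text \<open>\<open>I_Q\<close> is totally ordered, so finitely many bounds can be replaced by the
  one with the largest index. The diagonal argument below needs this at every stage.\<close>

lemma path_directed:
  assumes "finite G" "f \<in> cu_paths T P" "\<And>\<phi>. \<phi> \<in> G \<Longrightarrow> \<exists>m\<in>I_Q. \<phi> \<sqsubset> f m"
  shows "\<exists>m\<in>I_Q. \<forall>\<phi>\<in>G. \<phi> \<sqsubset> f m"
  using assms(1,3)
proof (induction G)
  case empty
  then show ?case using I_Q_seq_in by blast
next
  case (insert \<psi> G)
  then obtain m k where m: "m \<in> I_Q" "\<forall>\<phi>\<in>G. \<phi> \<sqsubset> f m" and k: "k \<in> I_Q" "\<psi> \<sqsubset> f k"
    by (metis insertCI)
  have "max m k \<in> I_Q" using m k by (auto simp: max_def)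
  moreover have "\<phi> \<sqsubset> f (max m k)" if "\<phi> \<in> insert \<psi> G" for \<phi>
    using that m k prec_path_mono[OF _ assms(2) _ calculation] by auto
  ultimately show ?case by blast
qed

lemma path_le_refl: "f \<in> cu_paths T P \<Longrightarrow> path_le T P f f"
  unfolding path_le_def using path_prec I_Q_above by metis

lemma path_le_trans: "path_le T P f g \<Longrightarrow> path_le T P g h \<Longrightarrow> path_le T P f h"
  unfolding path_le_def using prec_trans by meson

lemma path_le_chain:
  assumes "\<And>n. f n \<in> cu_paths T P" "\<And>n. path_le T P (f n) (f (Suc n))" "m \<le> n"
  shows "path_le T P (f m) (f n)"
  using assms(3)
proof (induction n rule: dec_induct)
  case base
  then show ?case using path_le_refl assms(1) by simp
next
  case (step n)
  then show ?case using path_le_trans assms(2) by simp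
qed

text \<open>A diagonal argument: among all maps \<open>f n l\<close> one selects a chain of order
  type omega that eventually dominates every one of them, and fills it in to a path by
  \<open>I_Q_chain\<close>.\<close>

lemma path_sup_exists:
  assumes f: "\<And>n. f n \<in> cu_paths T P" and le: "\<And>n. path_le T P (f n) (f (Suc n))"
  obtains h where "h \<in> cu_paths T P" "\<And>n. path_le T P (f n) h"
    "\<And>l. l \<in> I_Q \<Longrightarrow> \<exists>n. \<exists>m\<in>I_Q. h l \<sqsubset> f n m"
proof -
  \<comment> \<open>\<open>mor_prec\<close> need not interpolate between arbitrary maps; leaving room for \<open>l'\<close> on the
    path \<open>f n\<close> makes the relation \<open>R\<close> interpolative.\<close>
  define R where "R = (\<lambda>(n, l) (m, k). l \<in> I_Q \<and> k \<in> I_Q \<and> (\<exists>l'\<in>I_Q. l < l' \<and> f n l' \<sqsubset> f m k))"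
  have R: "R (n, l) (m, k) \<longleftrightarrow> l \<in> I_Q \<and> k \<in> I_Q \<and> (\<exists>l'\<in>I_Q. l < l' \<and> f n l' \<sqsubset> f m k)"
    for n l m k by (simp add: R_def)
  have R_prec: "f n l \<sqsubset> f m k" if "R (n, l) (m, k)" for n l m k
    using that f path_prec prec_trans unfolding R by meson
  have tr: "transp R"
  proof (rule transpI, clarify)
    fix n l m k j i assume "R (n, l) (m, k)" "R (m, k) (j, i)"
    then show "R (n, l) (j, i)" using R_prec prec_trans unfolding R by meson
  qed
  have interp: "\<forall>x y. R x y \<longrightarrow> (\<exists>z. R x z \<and> R z y)"
  proof (clarify)
    fix n l m k assume "R (n, l) (m, k)"
    then obtain l' where l: "l \<in> I_Q" "k \<in> I_Q" "l' \<in> I_Q" "l < l'" "f n l' \<sqsubset> f m k" by (auto simp: R)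
    obtain i where i: "i \<in> I_Q" "l < i" "i < l'" using I_Q_dense l by metis
    obtain j where j: "j \<in> I_Q" "l < j" "j < i" using I_Q_dense l i by metis
    have "R (n, l) (n, i)" using l i j path_prec[OF f] unfolding R by blast
    moreover have "R (n, i) (m, k)" using l i unfolding R by blast
    ultimately show "\<exists>z. R (n, l) z \<and> R z (m, k)" by blast
  qed
  \<comment> \<open>The n-th term dominates the first n + 1 paths up to index
    \<open>I_Q_seq n\<close>. Since both n and \<open>I_Q_seq n\<close> are cofinal, every
    \<open>f j l\<close> is dominated at some stage.\<close>
  have "\<exists>x. \<forall>n. (x n \<in> I_Q \<and> (\<forall>j\<le>n. f j (I_Q_seq n) \<sqsubset> f n (x n))) \<and> R (n, x n) (Suc n, x (Suc n))"
  proof (rule dependent_nat_choice)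
    show "\<exists>l. l \<in> I_Q \<and> (\<forall>j\<le>0. f j (I_Q_seq 0) \<sqsubset> f 0 l)"
      using path_le_refl[OF f] I_Q_seq_in unfolding path_le_def by blast
  next
    fix l n assume l: "l \<in> I_Q \<and> (\<forall>j\<le>n. f j (I_Q_seq n) \<sqsubset> f n l)"
    \<comment> \<open>The next term must dominate \<open>f n k\<close> with k strictly above l: this
      is the slack that R demands.\<close>
    obtain k where k: "k \<in> I_Q" "l < k" using I_Q_above l by metis
    define G where "G = insert (f n k) ((\<lambda>j. f j (I_Q_seq (Suc n))) ` {..Suc n})"
    have "\<exists>m\<in>I_Q. \<forall>\<phi>\<in>G. \<phi> \<sqsubset> f (Suc n) m"
    proof (rule path_directed)
      fix \<phi> assume "\<phi> \<in> G"
      then obtain j i where "\<phi> = f j i" "i \<in> I_Q" "j \<le> Suc n"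
        using k I_Q_seq_in by (auto simp: G_def)
      then show "\<exists>m\<in>I_Q. \<phi> \<sqsubset> f (Suc n) m"
        using path_le_chain[of f, OF f le] unfolding path_le_def by blast
    qed (use f G_def in auto)
    then show "\<exists>m. (m \<in> I_Q \<and> (\<forall>j\<le>Suc n. f j (I_Q_seq (Suc n)) \<sqsubset> f (Suc n) m)) \<and> R (n, l) (Suc n, m)"
      using k l unfolding R G_def by blast
  qed
  then obtain x where x: "\<And>n. x n \<in> I_Q" "\<And>n j. j \<le> n \<Longrightarrow> f j (I_Q_seq n) \<sqsubset> f n (x n)"
    "\<forall>n. R (n, x n) (Suc n, x (Suc n))" by metis
  obtain H where H: "\<And>l m. l \<in> I_Q \<Longrightarrow> m \<in> I_Q \<Longrightarrow> l < m \<Longrightarrow> R (H l) (H m)"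
    "\<And>l. l \<in> I_Q \<Longrightarrow> \<exists>n. R (H l) (n, x n)" "\<And>n. \<exists>l\<in>I_Q. R (n, x n) (H l)"
    using I_Q_chain[of R "\<lambda>n. (n, x n)", OF tr interp x(3)] by blast
  define h where "h = (\<lambda>l\<in>I_Q. f (fst (H l)) (snd (H l)))"
  have Hin: "snd (H l) \<in> I_Q" if "l \<in> I_Q" for l
    using H(2)[OF that] by (cases "H l") (auto simp: R)
  have "h \<in> cu_paths T P"
    unfolding cu_paths_def using H(1) Hin R_prec path_gen[OF f]
    by (auto simp: h_def)
  moreover have "path_le T P (f n) h" for n
    unfolding path_le_def
  proof
    fix l :: rat assume l: "l \<in> I_Q"
    then obtain k where k: "l < I_Q_seq k" using I_Q_seq_cofinal by auto
    \<comment> \<open>Late enough for path n to take part in the diagonal and for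
      \<open>I_Q_seq N\<close> to have passed l.\<close>
    define N where "N = max n k"
    have "l \<le> I_Q_seq N" using k I_Q_seq_less[of k n] by (auto simp: N_def max_def order_le_less)
    then have 1: "f n l \<sqsubset> f N (x N)"
      using path_prec_mono[OF x(2)[of n N] f l I_Q_seq_in] by (simp add: N_def)
    obtain m where m: "m \<in> I_Q" "R (N, x N) (H m)" using H(3) by blast
    then have "f N (x N) \<sqsubset> h m" using R_prec by (cases "H m") (auto simp: h_def)
    then show "\<exists>m\<in>I_Q. f n l \<sqsubset> h m" using 1 prec_trans m(1) by blast
  qed
  moreover have "\<exists>n. \<exists>m\<in>I_Q. h l \<sqsubset> f n m" if l: "l \<in> I_Q" for l
  proof -
    obtain n where "R (H l) (n, x n)" using H(2)[OF l] by blast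
    then have "h l \<sqsubset> f n (x n)" using R_prec l by (cases "H l") (auto simp: h_def)
    then show ?thesis using x(1) by blast
  qed
  ultimately show thesis by (rule that)
qed

end

section \<open>The internal hom\<close>

context cu_pair
begin

lemma path_leE:
  assumes "path_le T P f g" "l \<in> I_Q"
  obtains m where "m \<in> I_Q" "f l \<sqsubset> g m"
  using assms unfolding path_le_def by blast

lemma path_rel_equiv: "equiv (cu_paths T P) (path_rel T P)"
proof (rule equivI)
  show "path_rel T P \<subseteq> cu_paths T P \<times> cu_paths T P" by (auto simp: path_rel_def)
  show "refl_on (cu_paths T P) (path_rel T P)"
    by (auto simp: refl_on_def path_rel_def path_le_refl)
  show "sym (path_rel T P)" by (auto simp: sym_def path_rel_def)
  show "trans (path_rel T P)" by (auto simp: trans_def path_rel_def intro: path_le_trans)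
qed

lemma path_class_in: "f \<in> cu_paths T P \<Longrightarrow> f \<in> path_class T P f"
  by (simp add: path_class_def path_rel_def path_le_refl)

lemma path_class_iff:
  "g \<in> path_class T P f \<longleftrightarrow> f \<in> cu_paths T P \<and> g \<in> cu_paths T P \<and> path_le T P f g \<and> path_le T P g f"
  by (auto simp: path_class_def path_rel_def)

lemma path_class_eq_iff:
  "f \<in> cu_paths T P \<Longrightarrow> g \<in> cu_paths T P \<Longrightarrow>
    path_class T P f = path_class T P g \<longleftrightarrow> path_le T P f g \<and> path_le T P g f"
  unfolding path_class_def
  by (subst eq_equiv_class_iff[OF path_rel_equiv]) (auto simp: path_rel_def)

lemma ihom_carrier: "F \<in> carrier (ihom T P) \<longleftrightarrow> (\<exists>f\<in>cu_paths T P. F = path_class T P f)"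
  by (auto simp: ihom_def quotient_def path_class_def)

lemma ihom_carrierE:
  assumes "F \<in> carrier (ihom T P)"
  obtains f where "f \<in> cu_paths T P" "F = path_class T P f"
  using assms ihom_carrier by blast

lemma path_class_carrier: "f \<in> cu_paths T P \<Longrightarrow> path_class T P f \<in> carrier (ihom T P)"
  using ihom_carrier by blast

text \<open>The order on classes asks for some comparable representatives; transitivity of
  \<open>path_le\<close> moves the comparison to any prescribed ones.\<close>

lemma ihom_le:
  assumes "f \<in> cu_paths T P" "g \<in> cu_paths T P"
  shows "path_class T P f \<preceq>\<^bsub>ihom T P\<^esub> path_class T P g \<longleftrightarrow> path_le T P f g"
proof
  assume "path_class T P f \<preceq>\<^bsub>ihom T P\<^esub> path_class T P g"
  then obtain f' g' where "path_le T P f f'" "path_le T P f' g'" "path_le T P g' g"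
    by (auto simp: ihom_def path_class_iff)
  then show "path_le T P f g" using path_le_trans by metis
next
  assume "path_le T P f g"
  then show "path_class T P f \<preceq>\<^bsub>ihom T P\<^esub> path_class T P g"
    using assms[THEN path_class_in] by (auto simp: ihom_def)
qed

text \<open>(O4) in P makes the pointwise sums preserve suprema, and (O3) makes them increase along
  the path.\<close>

lemma path_add_closed:
  assumes "f \<in> cu_paths T P" "g \<in> cu_paths T P"
  shows "path_add T P f g \<in> cu_paths T P"
proof -
  have "(\<lambda>a\<in>carrier T. f l a \<oplus>\<^bsub>P\<^esub> g l a) \<in> gen_cu_mor T P" if l: "l \<in> I_Q" for l
  proof -
    note f = path_gen[OF assms(1) l] and g = path_gen[OF assms(2) l]
    have "is_sup P (range (\<lambda>n. (\<lambda>a\<in>carrier T. f l a \<oplus>\<^bsub>P\<^esub> g l a) (c n)))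
        ((\<lambda>a\<in>carrier T. f l a \<oplus>\<^bsub>P\<^esub> g l a) s)"
      if c: "increasing T c" "is_sup T (range c) s" for c s
      using P.O4[OF gen_cu_mor_increasing[OF f c(1)] gen_cu_mor_increasing[OF g c(1)]
          gen_cu_mor_sup[OF f c] gen_cu_mor_sup[OF g c]] c
      by (simp add: increasing_closed is_sup_closed)
    then show ?thesis
      by (auto simp: gen_cu_mor_def T.add_closed T.zero_closed P.add_closed P.zero_closed
          gen_cu_mor_closed[OF f] gen_cu_mor_closed[OF g] gen_cu_mor_add[OF f] gen_cu_mor_add[OF g]
          gen_cu_mor_zero[OF f] gen_cu_mor_zero[OF g] P.add_zero
          intro: P.add_interchange P.add_mono2 gen_cu_mor_mono[OF f] gen_cu_mor_mono[OF g])
  qed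
  moreover have "path_add T P f g l \<sqsubset> path_add T P f g m"
    if "l \<in> I_Q" "m \<in> I_Q" "l < m" for l m
    using that P.O3 precD[OF path_prec[OF assms(1)]] precD[OF path_prec[OF assms(2)]]
    by (simp add: mor_prec_def path_add_def way_below_closed)
  ultimately show ?thesis by (auto simp: cu_paths_def path_add_def)
qed

lemma path_add_le:
  assumes "f \<in> cu_paths T P" "g \<in> cu_paths T P" "f' \<in> cu_paths T P" "g' \<in> cu_paths T P"
    and "path_le T P f f'" "path_le T P g g'"
  shows "path_le T P (path_add T P f g) (path_add T P f' g')"
  unfolding path_le_def
proof
  fix l assume l: "l \<in> I_Q"
  obtain m k where m: "m \<in> I_Q" "f l \<sqsubset> f' m" and k: "k \<in> I_Q" "g l \<sqsubset> g' k"
    using assms(5,6) l unfolding path_le_def by meson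
  have mk: "max m k \<in> I_Q" using m k by (auto simp: max_def)
  have "f l \<sqsubset> f' (max m k)" "g l \<sqsubset> g' (max m k)"
    using prec_path_mono[OF m(2) assms(3) m(1) mk] prec_path_mono[OF k(2) assms(4) k(1) mk] by auto
  then have "path_add T P f g l \<sqsubset> path_add T P f' g' (max m k)"
    using l mk P.O3 by (simp add: mor_prec_def path_add_def way_below_closed)
  then show "\<exists>m\<in>I_Q. path_add T P f g l \<sqsubset> path_add T P f' g' m" using mk by blast
qed

lemma ihom_add:
  assumes "f \<in> cu_paths T P" "g \<in> cu_paths T P"
  shows "path_class T P f \<oplus>\<^bsub>ihom T P\<^esub> path_class T P g = path_class T P (path_add T P f g)"
proof -
  have "path_class T P (path_add T P f' g') = path_class T P (path_add T P f g)"
    if "f' \<in> path_class T P f" "g' \<in> path_class T P g" for f' g'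
    using that by (auto simp: path_class_iff path_class_eq_iff path_add_closed path_add_le)
  moreover have "path_class T P f \<noteq> {}" "path_class T P g \<noteq> {}"
    using assms path_class_in by blast+
  ultimately show ?thesis by (simp add: ihom_def cong: SUP_cong)
qed

lemma path_zero: "(\<lambda>l\<in>I_Q. \<lambda>a\<in>carrier T. \<zero>\<^bsub>P\<^esub>) \<in> cu_paths T P"
proof -
  \<comment> \<open>Zero is compact, being the least element; this allows a constant path.\<close>
  have z: "\<zero>\<^bsub>P\<^esub> \<lless>\<^bsub>P\<^esub> \<zero>\<^bsub>P\<^esub>"
    by (auto simp: way_below_def P.zero_closed P.zero_le increasing_closed)
  have "is_sup P (range (\<lambda>n. (\<lambda>a\<in>carrier T. \<zero>\<^bsub>P\<^esub>) (c n))) ((\<lambda>a\<in>carrier T. \<zero>\<^bsub>P\<^esub>) s)"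
    if "increasing T c" "is_sup T (range c) s" for c s
    using that P.is_sup_const[OF P.zero_closed] by (simp add: increasing_closed is_sup_closed)
  then have "(\<lambda>a\<in>carrier T. \<zero>\<^bsub>P\<^esub>) \<in> gen_cu_mor T P"
    by (auto simp: gen_cu_mor_def P.zero_closed T.zero_closed T.add_closed P.add_zero P.le_refl)
  moreover have "(\<lambda>a\<in>carrier T. \<zero>\<^bsub>P\<^esub>) \<sqsubset> (\<lambda>a\<in>carrier T. \<zero>\<^bsub>P\<^esub>)"
    using z by (simp add: mor_prec_def way_below_closed)
  ultimately show ?thesis by (auto simp: cu_paths_def)
qed

lemma ihom_zero: "\<zero>\<^bsub>ihom T P\<^esub> = path_class T P (\<lambda>l\<in>I_Q. \<lambda>a\<in>carrier T. \<zero>\<^bsub>P\<^esub>)"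
  by (simp add: ihom_def)

lemma ihom_zero_closed: "\<zero>\<^bsub>ihom T P\<^esub> \<in> carrier (ihom T P)"
  using path_class_carrier[OF path_zero] by (simp add: ihom_zero)

lemma ihom_add_closed:
  "F \<in> carrier (ihom T P) \<Longrightarrow> G \<in> carrier (ihom T P) \<Longrightarrow> F \<oplus>\<^bsub>ihom T P\<^esub> G \<in> carrier (ihom T P)"
  by (metis ihom_carrier ihom_add path_add_closed)

text \<open>Any upper bound k dominates all \<open>f n m\<close>, hence by cofinality all
  \<open>h l\<close>. This criterion produces every supremum needed in \<open>ihom\<close>.\<close>

lemma ihom_is_supI:
  assumes f: "\<And>n. f n \<in> cu_paths T P" and h: "h \<in> cu_paths T P"
    and upper: "\<And>n. path_le T P (f n) h"
    and cofinal: "\<And>l. l \<in> I_Q \<Longrightarrow> \<exists>n. \<exists>m\<in>I_Q. h l \<sqsubset> f n m"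
  shows "is_sup (ihom T P) (range (\<lambda>n. path_class T P (f n))) (path_class T P h)"
proof -
  have "path_le T P h k" if "k \<in> cu_paths T P" "\<And>n. path_le T P (f n) k" for k
    using cofinal that(2) prec_trans unfolding path_le_def by meson
  then have "path_class T P h \<preceq>\<^bsub>ihom T P\<^esub> K"
    if "K \<in> carrier (ihom T P)" "\<And>n. path_class T P (f n) \<preceq>\<^bsub>ihom T P\<^esub> K" for K
    using that f h by (auto simp: ihom_carrier ihom_le)
  then show ?thesis
    unfolding is_sup_def using f h upper by (auto simp: path_class_carrier ihom_le)
qed

lemma ihom_le_antisym:
  "\<lbrakk>F \<in> carrier (ihom T P); G \<in> carrier (ihom T P); F \<preceq>\<^bsub>ihom T P\<^esub> G; G \<preceq>\<^bsub>ihom T P\<^esub> F\<rbrakk> \<Longrightarrow> F = G"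
  by (metis ihom_carrier ihom_le path_class_eq_iff)

lemma ihom_le_refl: "F \<in> carrier (ihom T P) \<Longrightarrow> F \<preceq>\<^bsub>ihom T P\<^esub> F"
  by (auto simp: ihom_carrier ihom_le path_le_refl)

lemma ihom_increasing_rep:
  assumes "increasing (ihom T P) F"
  obtains f where "\<And>n. f n \<in> cu_paths T P" "\<And>n. F n = path_class T P (f n)"
    "\<And>n. path_le T P (f n) (f (Suc n))"
proof -
  have "\<forall>n. \<exists>f\<in>cu_paths T P. F n = path_class T P f"
    using assms by (simp add: increasing_def ihom_carrier)
  then obtain f where f: "\<And>n. f n \<in> cu_paths T P" "\<And>n. F n = path_class T P (f n)" by metis
  moreover have "path_le T P (f n) (f (Suc n))" for n
    using assms f by (simp add: increasing_def ihom_le)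
  ultimately show thesis by (rule that)
qed

lemma ihom_increasingI:
  "(\<And>n. f n \<in> cu_paths T P) \<Longrightarrow> (\<And>n. path_le T P (f n) (f (Suc n))) \<Longrightarrow>
    increasing (ihom T P) (\<lambda>n. path_class T P (f n))"
  by (simp add: increasing_def path_class_carrier ihom_le)

text \<open>The path k built in \<open>path_sup_exists\<close> is cofinal by construction and its
  class is an upper bound. As h represents the least one, h lies below k and inherits the
  property.\<close>

lemma ihom_sup_cofinal:
  assumes f: "\<And>n. f n \<in> cu_paths T P" and inc: "\<And>n. path_le T P (f n) (f (Suc n))"
    and h: "h \<in> cu_paths T P"
    and sup: "is_sup (ihom T P) (range (\<lambda>n. path_class T P (f n))) (path_class T P h)"
    and l: "l \<in> I_Q"
  shows "\<exists>n. \<exists>m\<in>I_Q. h l \<sqsubset> f n m"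
proof -
  obtain k where k: "k \<in> cu_paths T P" "\<And>n. path_le T P (f n) k"
    "\<And>l. l \<in> I_Q \<Longrightarrow> \<exists>n. \<exists>m\<in>I_Q. k l \<sqsubset> f n m"
    using path_sup_exists[of f, OF f inc] by metis
  have "x \<preceq>\<^bsub>ihom T P\<^esub> path_class T P k" if "x \<in> range (\<lambda>n. path_class T P (f n))" for x
    using that k f by (auto simp: ihom_le)
  then have "path_class T P h \<preceq>\<^bsub>ihom T P\<^esub> path_class T P k"
    by (rule is_sup_least[OF sup path_class_carrier[OF k(1)]])
  then have "path_le T P h k" using h k(1) by (simp add: ihom_le)
  then obtain m where "m \<in> I_Q" "h l \<sqsubset> k m" using l by (rule path_leE)
  then show ?thesis using k(3) prec_trans by meson
qed

text \<open>The path g slowed down so as to stop before index p; such truncations are the test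
  sequence for \<open>\<lless>\<close> in the next lemma.\<close>

lemma path_scale:
  assumes g: "g \<in> cu_paths T P" and p: "p \<in> I_Q"
  shows "(\<lambda>l\<in>I_Q. g (l * p)) \<in> cu_paths T P"
proof -
  have "l * p \<in> I_Q" if "l \<in> I_Q" for l
    using that p mult_strict_mono[of l 1 p 1] by auto
  then show ?thesis
    unfolding cu_paths_def using path_gen[OF g] path_prec[OF g] p by auto
qed

text \<open>Forwards, [g] is the supremum of its truncations; [f] lies below one of them, and that
  truncation is bounded by a single map of g. Backwards, the bounding map is itself dominated at
  some stage of any increasing sequence whose supremum lies above [g].\<close>

lemma ihom_way_below_iff:
  assumes f: "f \<in> cu_paths T P" and g: "g \<in> cu_paths T P"
  shows "path_class T P f \<lless>\<^bsub>ihom T P\<^esub> path_class T P g \<longleftrightarrow> (\<exists>l\<in>I_Q. \<forall>m\<in>I_Q. f m \<sqsubset> g l)"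
proof
  assume wb: "path_class T P f \<lless>\<^bsub>ihom T P\<^esub> path_class T P g"
  define G where "G n = (\<lambda>l\<in>I_Q. g (l * I_Q_seq n))" for n
  have G: "G n \<in> cu_paths T P" for n unfolding G_def by (rule path_scale[OF g I_Q_seq_in])
  have mult_in: "l * I_Q_seq n \<in> I_Q" "l * I_Q_seq n < l" if "l \<in> I_Q" for l n
    using that I_Q_seq_in[of n] mult_strict_mono[of l 1 "I_Q_seq n" 1] by auto
  have inc: "path_le T P (G n) (G (Suc n))" for n
    unfolding path_le_def
  proof
    fix l assume l: "l \<in> I_Q"
    have "l * I_Q_seq n < l * I_Q_seq (Suc n)" using l I_Q_seq_less[of n "Suc n"] by simp
    then have "G n l \<sqsubset> G (Suc n) l" unfolding G_def using l path_prec[OF g mult_in(1) mult_in(1)] by simp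
    then show "\<exists>m\<in>I_Q. G n l \<sqsubset> G (Suc n) m" using l by blast
  qed
  have upper: "path_le T P (G n) g" for n
    unfolding path_le_def
  proof
    fix l assume l: "l \<in> I_Q"
    have "G n l \<sqsubset> g l" unfolding G_def using l path_prec[OF g mult_in(1) _ mult_in(2)] by simp
    then show "\<exists>m\<in>I_Q. G n l \<sqsubset> g m" using l by blast
  qed
  have "\<exists>n. \<exists>m\<in>I_Q. g l \<sqsubset> G n m" if l: "l \<in> I_Q" for l
  proof -
    obtain n where n: "l < I_Q_seq n" using I_Q_seq_cofinal l by auto
    then have "l / I_Q_seq n < 1" using I_Q_seq_in[of n] by simp
    \<comment> \<open>Any index m beyond the quotient has passed l after multiplication by
      \<open>I_Q_seq n\<close>.\<close>
    then obtain m where m: "l / I_Q_seq n < m" "m < 1" using dense by blast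
    moreover have "0 < l / I_Q_seq n" using l I_Q_seq_in[of n] by simp
    ultimately have "m \<in> I_Q" by simp
    moreover have "l < m * I_Q_seq n" using m(1) I_Q_seq_in[of n] by (simp add: field_simps)
    ultimately have "g l \<sqsubset> G n m" using path_prec[OF g l mult_in(1)] by (simp add: G_def)
    then show ?thesis using \<open>m \<in> I_Q\<close> by blast
  qed
  then have "is_sup (ihom T P) (range (\<lambda>n. path_class T P (G n))) (path_class T P g)"
    using ihom_is_supI[of G, OF G g upper] by blast
  then obtain n where "path_class T P f \<preceq>\<^bsub>ihom T P\<^esub> path_class T P (G n)"
    using way_belowD[OF wb ihom_increasingI[of G, OF G inc]] ihom_le_refl[OF path_class_carrier[OF g]]
    by blast
  then have "path_le T P f (G n)" using f G by (simp add: ihom_le)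
  have "f m \<sqsubset> g (I_Q_seq n)" if "m \<in> I_Q" for m
  proof -
    obtain l where l: "l \<in> I_Q" "f m \<sqsubset> G n l"
      using path_leE[OF \<open>path_le T P f (G n)\<close> \<open>m \<in> I_Q\<close>] by blast
    have "l * I_Q_seq n < I_Q_seq n" using l(1) I_Q_seq_in[of n] by simp
    then have "G n l \<sqsubset> g (I_Q_seq n)" using path_prec[OF g mult_in(1)[OF l(1)] I_Q_seq_in] l(1) by (simp add: G_def)
    then show ?thesis using l(2) prec_trans by blast
  qed
  then show "\<exists>l\<in>I_Q. \<forall>m\<in>I_Q. f m \<sqsubset> g l" using I_Q_seq_in by blast
next
  assume "\<exists>l\<in>I_Q. \<forall>m\<in>I_Q. f m \<sqsubset> g l"
  then obtain l where l: "l \<in> I_Q" "\<And>m. m \<in> I_Q \<Longrightarrow> f m \<sqsubset> g l" by blast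
  have "\<exists>k. path_class T P f \<preceq>\<^bsub>ihom T P\<^esub> F k"
    if F: "increasing (ihom T P) F" "is_sup (ihom T P) (range F) s" "path_class T P g \<preceq>\<^bsub>ihom T P\<^esub> s" for F s
  proof -
    obtain h where h: "\<And>n. h n \<in> cu_paths T P" "\<And>n. F n = path_class T P (h n)"
      "\<And>n. path_le T P (h n) (h (Suc n))" using ihom_increasing_rep[OF F(1)] by metis
    obtain k where k: "k \<in> cu_paths T P" "s = path_class T P k"
      using is_sup_closed[OF F(2)] by (auto simp: ihom_carrier)
    have "path_le T P g k" using F(3) k g by (simp add: ihom_le)
    then obtain m where m: "m \<in> I_Q" "g l \<sqsubset> k m" using l(1) by (rule path_leE)
    have "F = (\<lambda>n. path_class T P (h n))" using h(2) by blast
    then obtain n i where "i \<in> I_Q" "k m \<sqsubset> h n i"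
      using ihom_sup_cofinal[of h, OF h(1,3) k(1) _ m(1)] F(2) k(2) by blast
    \<comment> \<open>The stage n works for all indices of f at once because the same
      \<open>g l\<close> bounds all of f.\<close>
    then have "path_le T P f (h n)" unfolding path_le_def using l(2) m(2) prec_trans by meson
    then show ?thesis using h f by (auto simp: ihom_le)
  qed
  then show "path_class T P f \<lless>\<^bsub>ihom T P\<^esub> path_class T P g"
    unfolding way_below_def using path_class_carrier[OF f] path_class_carrier[OF g] by blast
qed

text \<open>(O1) provides a supremum only along \<open>I_Q_seq\<close>; cofinality turns it into the
  supremum over all of \<open>I_Q\<close> by which the endpoint is defined. The sequential form is
  what (O4) and morphisms can use.\<close>

lemma path_endpoint_sup:
  assumes f: "f \<in> cu_paths T P" and a: "a \<in> carrier T"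
  shows "is_sup P ((\<lambda>l. f l a) ` I_Q) (path_endpoint T P f a)"
    and "is_sup P (range (\<lambda>n. f (I_Q_seq n) a)) (path_endpoint T P f a)"
    and "increasing P (\<lambda>n. f (I_Q_seq n) a)"
proof -
  show inc: "increasing P (\<lambda>n. f (I_Q_seq n) a)"
    using path_closed[OF f I_Q_seq_in a] path_mono[OF f I_Q_seq_in I_Q_seq_in _ a] I_Q_seq_less
    by (simp add: increasing_def order_less_imp_le)
  obtain s where s: "is_sup P (range (\<lambda>n. f (I_Q_seq n) a)) s" using P.O1[OF inc] by blast
  have sup: "is_sup P ((\<lambda>l. f l a) ` I_Q) s"
  proof (rule P.is_sup_range_cofinal[OF s])
    show "(\<lambda>l. f l a) ` I_Q \<subseteq> carrier P" using path_closed[OF f _ a] by blast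
    fix y assume "y \<in> (\<lambda>l. f l a) ` I_Q"
    then obtain l where l: "l \<in> I_Q" "y = f l a" by blast
    then obtain n where "l < I_Q_seq n" using I_Q_seq_cofinal by auto
    then have "y \<preceq>\<^bsub>P\<^esub> f (I_Q_seq n) a" using path_mono[OF f l(1) I_Q_seq_in _ a] l(2) by simp
    then show "\<exists>x\<in>range (\<lambda>n. f (I_Q_seq n) a). y \<preceq>\<^bsub>P\<^esub> x" by blast
  next
    fix x assume "x \<in> range (\<lambda>n. f (I_Q_seq n) a)"
    then obtain n where n: "x = f (I_Q_seq n) a" by blast
    have "x \<preceq>\<^bsub>P\<^esub> x" unfolding n using P.le_refl path_closed[OF f I_Q_seq_in a] by blast
    then show "\<exists>y\<in>(\<lambda>l. f l a) ` I_Q. x \<preceq>\<^bsub>P\<^esub> y" using n I_Q_seq_in by blast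
  qed
  then have "path_endpoint T P f a = s" using a by (simp add: path_endpoint_def P.the_sup_eq)
  then show "is_sup P ((\<lambda>l. f l a) ` I_Q) (path_endpoint T P f a)"
    "is_sup P (range (\<lambda>n. f (I_Q_seq n) a)) (path_endpoint T P f a)" using s sup by simp_all
qed

lemma path_le_endpoint:
  assumes "f \<in> cu_paths T P" "l \<in> I_Q" "a \<in> carrier T"
  shows "f l a \<preceq>\<^bsub>P\<^esub> path_endpoint T P f a"
  using is_sup_upper[OF path_endpoint_sup(1)[OF assms(1,3)]] assms(2) by blast

lemma path_endpoint_closed:
  "f \<in> cu_paths T P \<Longrightarrow> a \<in> carrier T \<Longrightarrow> path_endpoint T P f a \<in> carrier P"
  using path_endpoint_sup(1) is_sup_closed by metis

lemma path_endpoint_least: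
  assumes "f \<in> cu_paths T P" "a \<in> carrier T" "u \<in> carrier P" "\<And>l. l \<in> I_Q \<Longrightarrow> f l a \<preceq>\<^bsub>P\<^esub> u"
  shows "path_endpoint T P f a \<preceq>\<^bsub>P\<^esub> u"
  using is_sup_least[OF path_endpoint_sup(1)[OF assms(1,2)] assms(3)] assms(4) by blast

lemma path_endpoint_mono:
  assumes f: "f \<in> cu_paths T P" and g: "g \<in> cu_paths T P" and le: "path_le T P f g"
    and a: "a \<in> carrier T"
  shows "path_endpoint T P f a \<preceq>\<^bsub>P\<^esub> path_endpoint T P g a"
proof (rule path_endpoint_least[OF f a path_endpoint_closed[OF g a]])
  fix l assume l: "l \<in> I_Q"
  then obtain m where m: "m \<in> I_Q" "f l \<sqsubset> g m" using path_leE[OF le] by blast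
  show "f l a \<preceq>\<^bsub>P\<^esub> path_endpoint T P g a"
    using P.le_trans[OF path_closed[OF f l a] path_closed[OF g m(1) a] path_endpoint_closed[OF g a]
        prec_le[OF m(2) path_gen[OF f l] path_gen[OF g m(1)] a] path_le_endpoint[OF g m(1) a]] .
qed

text \<open>Equivalent paths bound each other, so their endpoints agree by antisymmetry and the
  image under \<open>the_elem\<close> is a singleton.\<close>

lemma endpoint_class:
  assumes f: "f \<in> cu_paths T P"
  shows "endpoint T P (path_class T P f) = path_endpoint T P f"
proof -
  have "path_endpoint T P g = path_endpoint T P f" if "g \<in> path_class T P f" for g
  proof
    fix a
    show "path_endpoint T P g a = path_endpoint T P f a"
    proof (cases "a \<in> carrier T")
      case True
      then show ?thesis
        using that path_endpoint_mono path_endpoint_closed P.le_antisym by (simp add: path_class_iff)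
    qed (simp add: path_endpoint_def)
  qed
  then have "path_endpoint T P ` path_class T P f = {path_endpoint T P f}"
    using path_class_in[OF f] by blast
  then show ?thesis by (simp add: endpoint_def)
qed

end

section \<open>The endpoint bimorphism\<close>

context cu_pair
begin

lemma endpoint_zero_left:
  assumes "b \<in> carrier T"
  shows "endpoint T P \<zero>\<^bsub>ihom T P\<^esub> b = \<zero>\<^bsub>P\<^esub>"
proof -
  have sup: "is_sup P (range (\<lambda>n::nat. \<zero>\<^bsub>P\<^esub>)) (path_endpoint T P (\<lambda>l\<in>I_Q. \<lambda>a\<in>carrier T. \<zero>\<^bsub>P\<^esub>) b)"
    using path_endpoint_sup(2)[OF path_zero assms] I_Q_seq_in assms by simp
  then show ?thesis
    using P.is_sup_unique[OF sup P.is_sup_const[OF P.zero_closed]]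
    by (simp add: ihom_zero endpoint_class[OF path_zero])
qed

lemma path_endpoint_zero:
  assumes f: "f \<in> cu_paths T P"
  shows "path_endpoint T P f \<zero>\<^bsub>T\<^esub> = \<zero>\<^bsub>P\<^esub>"
proof -
  have sup: "is_sup P (range (\<lambda>n::nat. \<zero>\<^bsub>P\<^esub>)) (path_endpoint T P f \<zero>\<^bsub>T\<^esub>)"
    using path_endpoint_sup(2)[OF f T.zero_closed] gen_cu_mor_zero[OF path_gen[OF f I_Q_seq_in]] by simp
  then show ?thesis using P.is_sup_unique[OF _ P.is_sup_const[OF P.zero_closed]] by blast
qed

lemma path_endpoint_add:
  assumes f: "f \<in> cu_paths T P" and a: "a \<in> carrier T" and b: "b \<in> carrier T"
  shows "path_endpoint T P f (a \<oplus>\<^bsub>T\<^esub> b) = path_endpoint T P f a \<oplus>\<^bsub>P\<^esub> path_endpoint T P f b"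
proof -
  have "is_sup P (range (\<lambda>n. f (I_Q_seq n) (a \<oplus>\<^bsub>T\<^esub> b))) (path_endpoint T P f a \<oplus>\<^bsub>P\<^esub> path_endpoint T P f b)"
    using P.O4[OF path_endpoint_sup(3)[OF f a] path_endpoint_sup(3)[OF f b]
        path_endpoint_sup(2)[OF f a] path_endpoint_sup(2)[OF f b]]
      gen_cu_mor_add[OF path_gen[OF f I_Q_seq_in] a b] by simp
  then show ?thesis using P.is_sup_unique[OF path_endpoint_sup(2)[OF f T.add_closed[OF a b]]] by blast
qed

lemma path_endpoint_path_add:
  assumes f: "f \<in> cu_paths T P" and g: "g \<in> cu_paths T P" and a: "a \<in> carrier T"
  shows "path_endpoint T P (path_add T P f g) a = path_endpoint T P f a \<oplus>\<^bsub>P\<^esub> path_endpoint T P g a"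
proof -
  have "is_sup P (range (\<lambda>n. path_add T P f g (I_Q_seq n) a))
      (path_endpoint T P f a \<oplus>\<^bsub>P\<^esub> path_endpoint T P g a)"
    using P.O4[OF path_endpoint_sup(3)[OF f a] path_endpoint_sup(3)[OF g a]
        path_endpoint_sup(2)[OF f a] path_endpoint_sup(2)[OF g a]] I_Q_seq_in a
    by (simp add: path_add_def)
  then show ?thesis
    using P.is_sup_unique[OF path_endpoint_sup(2)[OF path_add_closed[OF f g] a]] by blast
qed

lemma path_endpoint_mono_arg:
  assumes f: "f \<in> cu_paths T P" and ab: "a \<in> carrier T" "b \<in> carrier T" "a \<preceq>\<^bsub>T\<^esub> b"
  shows "path_endpoint T P f a \<preceq>\<^bsub>P\<^esub> path_endpoint T P f b"
proof (rule path_endpoint_least[OF f ab(1) path_endpoint_closed[OF f ab(2)]])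
  fix l assume l: "l \<in> I_Q"
  show "f l a \<preceq>\<^bsub>P\<^esub> path_endpoint T P f b"
    using P.le_trans[OF path_closed[OF f l ab(1)] path_closed[OF f l ab(2)] path_endpoint_closed[OF f ab(2)]
        gen_cu_mor_mono[OF path_gen[OF f l] ab] path_le_endpoint[OF f l ab(2)]] .
qed

lemma endpoint_closed:
  "F \<in> carrier (ihom T P) \<Longrightarrow> b \<in> carrier T \<Longrightarrow> endpoint T P F b \<in> carrier P"
  by (auto simp: ihom_carrier endpoint_class path_endpoint_closed)

lemma endpoint_mono:
  assumes "F \<in> carrier (ihom T P)" "G \<in> carrier (ihom T P)" "F \<preceq>\<^bsub>ihom T P\<^esub> G"
    and "a \<in> carrier T" "b \<in> carrier T" "a \<preceq>\<^bsub>T\<^esub> b"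
  shows "endpoint T P F a \<preceq>\<^bsub>P\<^esub> endpoint T P G b"
proof -
  obtain f where f: "f \<in> cu_paths T P" "F = path_class T P f"
      using ihom_carrierE[OF assms(1)] .
    obtain g where g: "g \<in> cu_paths T P" "G = path_class T P g"
      using ihom_carrierE[OF assms(2)] .
  have "path_le T P f g" using assms(3) f g by (simp add: ihom_le)
  then show ?thesis
    using P.le_trans[OF path_endpoint_closed[OF f(1) assms(4)] path_endpoint_closed[OF g(1) assms(4)]
        path_endpoint_closed[OF g(1) assms(5)] path_endpoint_mono[OF f(1) g(1) _ assms(4)]
        path_endpoint_mono_arg[OF g(1) assms(4-6)]]
    by (simp add: f g endpoint_class)
qed

text \<open>Joint continuity: cofinality in the first variable and preservation of suprema by each
  \<open>g l\<close> in the second are merged on the diagonal.\<close>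

lemma endpoint_sup:
  assumes F: "increasing (ihom T P) F" "is_sup (ihom T P) (range F) G"
    and c: "increasing T c" "is_sup T (range c) b"
  shows "is_sup P (range (\<lambda>k. endpoint T P (F k) (c k))) (endpoint T P G b)"
proof -
  obtain f where f: "\<And>n. f n \<in> cu_paths T P" "\<And>n. F n = path_class T P (f n)"
    "\<And>n. path_le T P (f n) (f (Suc n))" using ihom_increasing_rep[OF F(1)] by metis
  obtain g where g: "g \<in> cu_paths T P" "G = path_class T P g"
    using ihom_carrierE[OF is_sup_closed[OF F(2)]] .
  have b: "b \<in> carrier T" using c(2) by (rule is_sup_closed)
  note cT = increasing_closed[OF c(1)]
  have "endpoint T P (F k) (c k) \<preceq>\<^bsub>P\<^esub> endpoint T P G b" for k
    using endpoint_mono[OF increasing_closed[OF F(1)] is_sup_closed[OF F(2)] is_sup_upper[OF F(2)]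
      cT b is_sup_upper[OF c(2)]] by blast
  moreover have "endpoint T P G b \<preceq>\<^bsub>P\<^esub> u"
    if u: "u \<in> carrier P" "\<And>k. endpoint T P (F k) (c k) \<preceq>\<^bsub>P\<^esub> u" for u
  proof -
    have "g l (c k) \<preceq>\<^bsub>P\<^esub> u" if l: "l \<in> I_Q" for l k
    proof -
      have "F = (\<lambda>n. path_class T P (f n))" using f(2) by blast
      then obtain n m where m: "m \<in> I_Q" "g l \<sqsubset> f n m"
        using ihom_sup_cofinal[of f, OF f(1,3) g(1) _ l] F(2) g(2) by blast
      \<comment> \<open>At N both arguments can be raised: \<open>g l\<close> is dominated by path
        N, and \<open>c k\<close> lies below \<open>c N\<close>. So \<open>g l (c k)\<close> is
        below the diagonal term N, hence below u.\<close>
      define N where "N = max n k"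
      have "path_le T P (f n) (f N)" using path_le_chain[of f, OF f(1,3)] by (simp add: N_def)
      then obtain i where i: "i \<in> I_Q" "f n m \<sqsubset> f N i" using m(1) by (rule path_leE)
      have "g l (c k) \<preceq>\<^bsub>P\<^esub> f N i (c k)"
        using prec_le[OF prec_trans[OF m(2) i(2)] path_gen[OF g(1) l] path_gen[OF f(1) i(1)] cT] .
      moreover have "f N i (c k) \<preceq>\<^bsub>P\<^esub> path_endpoint T P (f N) (c k)"
        by (rule path_le_endpoint[OF f(1) i(1) cT])
      moreover have "path_endpoint T P (f N) (c k) \<preceq>\<^bsub>P\<^esub> path_endpoint T P (f N) (c N)"
        using path_endpoint_mono_arg[OF f(1) cT cT] T.increasing_le[OF c(1)] by (simp add: N_def)
      moreover have "path_endpoint T P (f N) (c N) \<preceq>\<^bsub>P\<^esub> u"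
        using u(2)[of N] by (simp add: f endpoint_class)
      moreover have "g l (c k) \<in> carrier P" "f N i (c k) \<in> carrier P"
        "path_endpoint T P (f N) (c k) \<in> carrier P" "path_endpoint T P (f N) (c N) \<in> carrier P"
        using path_closed path_endpoint_closed f g l i cT by simp_all
      ultimately show ?thesis using u(1) P.le_trans by metis
    qed
    then have "g l b \<preceq>\<^bsub>P\<^esub> u" if "l \<in> I_Q" for l
      using is_sup_least[OF gen_cu_mor_sup[OF path_gen[OF g(1) that] c] u(1)] that by blast
    then show ?thesis using path_endpoint_least[OF g(1) b u(1)] by (simp add: g endpoint_class)
  qed
  moreover have "range (\<lambda>k. endpoint T P (F k) (c k)) \<subseteq> carrier P" "endpoint T P G b \<in> carrier P"
    using endpoint_closed[OF increasing_closed[OF F(1)] cT] endpoint_closed[OF is_sup_closed[OF F(2)] b]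
    by auto
  ultimately show ?thesis by (auto simp: is_sup_def)
qed

text \<open>The map \<open>g l\<close> bounding all of f bounds its endpoint too, but only up to an
  interpolant c. A second, larger index k then supplies the strict relation \<open>g l c\<close>
  \<open>\<lless>\<close> \<open>g k b\<close>.\<close>

lemma endpoint_way_below:
  assumes F: "F \<lless>\<^bsub>ihom T P\<^esub> G" and b: "b' \<lless>\<^bsub>T\<^esub> b"
  shows "endpoint T P F b' \<lless>\<^bsub>P\<^esub> endpoint T P G b"
proof -
  obtain f where f: "f \<in> cu_paths T P" "F = path_class T P f"
      using ihom_carrierE[OF way_below_closed(1)[OF F]] .
    obtain g where g: "g \<in> cu_paths T P" "G = path_class T P g"
      using ihom_carrierE[OF way_below_closed(2)[OF F]] .
  obtain l where l: "l \<in> I_Q" "\<And>m. m \<in> I_Q \<Longrightarrow> f m \<sqsubset> g l"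
    using F ihom_way_below_iff[OF f(1) g(1)] f(2) g(2) by blast
  obtain k where k: "k \<in> I_Q" "l < k" using I_Q_above[OF l(1)] .
  obtain c where c: "b' \<lless>\<^bsub>T\<^esub> c" "c \<lless>\<^bsub>T\<^esub> b" using T.way_below_interpolate[OF b] .
  note cl = way_below_closed[OF c(1)] way_below_closed[OF c(2)]
  have "path_endpoint T P f b' \<preceq>\<^bsub>P\<^esub> g l c"
    using path_endpoint_least[OF f(1) cl(1) path_closed[OF g(1) l(1) cl(2)]]
      P.way_below_le[OF precD[OF l(2) c(1)]] by blast
  moreover have "g l c \<lless>\<^bsub>P\<^esub> g k b"
    using precD[OF path_prec[OF g(1) l(1) k] c(2)] .
  ultimately have "path_endpoint T P f b' \<lless>\<^bsub>P\<^esub> g k b"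
    using P.le_way_below path_endpoint_closed[OF f(1) cl(1)] by blast
  then show ?thesis
    using P.way_below_le_trans path_le_endpoint[OF g(1) k(1) cl(4)] path_endpoint_closed[OF g(1) cl(4)]
    by (simp add: f g endpoint_class)
qed

lemma endpoint_bimorphism: "cu_bimorphism (ihom T P) T P (endpoint T P)"
proof -
  have "endpoint T P (F \<oplus>\<^bsub>ihom T P\<^esub> G) b = endpoint T P F b \<oplus>\<^bsub>P\<^esub> endpoint T P G b"
    if "F \<in> carrier (ihom T P)" "G \<in> carrier (ihom T P)" "b \<in> carrier T" for F G b
    using that by (auto simp: ihom_carrier ihom_add endpoint_class path_add_closed path_endpoint_path_add)
  moreover have "endpoint T P F (a \<oplus>\<^bsub>T\<^esub> b) = endpoint T P F a \<oplus>\<^bsub>P\<^esub> endpoint T P F b"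
    if "F \<in> carrier (ihom T P)" "a \<in> carrier T" "b \<in> carrier T" for F a b
    using that by (auto simp: ihom_carrier endpoint_class path_endpoint_add)
  moreover have "endpoint T P F \<zero>\<^bsub>T\<^esub> = \<zero>\<^bsub>P\<^esub>" if "F \<in> carrier (ihom T P)" for F
    using that by (auto simp: ihom_carrier endpoint_class path_endpoint_zero)
  ultimately show ?thesis
    unfolding cu_bimorphism_def
    by (intro conjI ballI allI impI endpoint_sup endpoint_way_below endpoint_mono endpoint_closed
        endpoint_zero_left ihom_le_refl T.le_refl) auto
qed

text \<open>The witness of \<open>\<lless>\<close> in \<^const>\<open>ihom\<close> bounds the whole path, so endpoints recover
  order relations between way-below approximants.\<close>

lemma endpoint_le_imp_le:
  assumes F: "F' \<lless>\<^bsub>ihom T P\<^esub> F" and G: "G' \<lless>\<^bsub>ihom T P\<^esub> G"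
    and le: "\<And>b. b \<in> carrier T \<Longrightarrow> endpoint T P F b \<preceq>\<^bsub>P\<^esub> endpoint T P G' b"
  shows "F' \<preceq>\<^bsub>ihom T P\<^esub> G"
proof -
  obtain f' where f': "f' \<in> cu_paths T P" and fF': "F' = path_class T P f'"
    using ihom_carrierE[OF way_below_closed(1)[OF F]] .
  obtain f where f: "f \<in> cu_paths T P" and fF: "F = path_class T P f"
    using ihom_carrierE[OF way_below_closed(2)[OF F]] .
  obtain g' where g': "g' \<in> cu_paths T P" and gG': "G' = path_class T P g'"
    using ihom_carrierE[OF way_below_closed(1)[OF G]] .
  obtain g where g: "g \<in> cu_paths T P" and gG: "G = path_class T P g"
    using ihom_carrierE[OF way_below_closed(2)[OF G]] .
  obtain l where l: "l \<in> I_Q" "\<And>m. m \<in> I_Q \<Longrightarrow> f' m \<sqsubset> f l"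
    using F ihom_way_below_iff[OF f' f] fF' fF by blast
  obtain k where k: "k \<in> I_Q" "\<And>m. m \<in> I_Q \<Longrightarrow> g' m \<sqsubset> g k"
    using G ihom_way_below_iff[OF g' g] gG' gG by blast
  have "f' m \<sqsubset> g k" if m: "m \<in> I_Q" for m
    unfolding mor_prec_def
  proof (intro allI impI)
    fix b' b assume "b' \<lless>\<^bsub>T\<^esub> b"
    then obtain c where c: "b' \<lless>\<^bsub>T\<^esub> c" "c \<lless>\<^bsub>T\<^esub> b" by (rule T.way_below_interpolate)
    note cl = way_below_closed[OF c(1)] way_below_closed[OF c(2)]
    have "f' m b' \<lless>\<^bsub>P\<^esub> f l c" using precD[OF l(2)[OF m] c(1)] .
    moreover have "f l c \<preceq>\<^bsub>P\<^esub> path_endpoint T P f c" using path_le_endpoint[OF f l(1) cl(2)] .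
    moreover have "path_endpoint T P f c \<preceq>\<^bsub>P\<^esub> path_endpoint T P g' c"
      using le[OF cl(2)] by (simp add: fF gG' endpoint_class f g')
    \<comment> \<open>Here it matters that one map \<open>g k\<close> bounds the whole path g' and
      hence its endpoint.\<close>
    moreover have "path_endpoint T P g' c \<preceq>\<^bsub>P\<^esub> g k b"
      using path_endpoint_least[OF g' cl(2) path_closed[OF g k(1) cl(4)]]
        P.way_below_le[OF precD[OF k(2) c(2)]] by blast
    ultimately show "f' m b' \<lless>\<^bsub>P\<^esub> g k b"
      using P.way_below_le_trans path_endpoint_closed[OF f cl(2)] path_endpoint_closed[OF g' cl(2)]
        path_closed[OF g k(1) cl(4)] by metis
  qed
  then have "path_le T P f' g" using k(1) unfolding path_le_def by blast
  then show ?thesis using f' g by (simp add: fF' gG ihom_le)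
qed

text \<open>Approximate a by a \<open>\<lless>\<close>-chain c and compare at
  \<open>c (Suc n)\<close>: this leaves room below on the \<alpha> side, at \<open>c n\<close>, and
  above on the \<beta> side, at a. Then pass to the supremum over n.\<close>

lemma cu_mor_ihom_le:
  assumes S: "cu_semigroup S" and \<alpha>: "\<alpha> \<in> cu_mor S (ihom T P)" and \<beta>: "\<beta> \<in> cu_mor S (ihom T P)"
    and le: "\<And>a b. a \<in> carrier S \<Longrightarrow> b \<in> carrier T \<Longrightarrow> endpoint T P (\<alpha> a) b \<preceq>\<^bsub>P\<^esub> endpoint T P (\<beta> a) b"
    and a: "a \<in> carrier S"
  shows "\<alpha> a \<preceq>\<^bsub>ihom T P\<^esub> \<beta> a"
proof -
  interpret S: cu_semigroup S by fact
  obtain c where c: "\<And>n. c n \<lless>\<^bsub>S\<^esub> c (Suc n)" "is_sup S (range c) a" "increasing S c" "\<And>n. c n \<lless>\<^bsub>S\<^esub> a"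
    using S.way_below_chain[OF a] by blast
  have "\<alpha> (c n) \<preceq>\<^bsub>ihom T P\<^esub> \<beta> a" for n
    using endpoint_le_imp_le[OF cu_mor_way_below[OF \<alpha> c(1)] cu_mor_way_below[OF \<beta> c(4)]] le
      increasing_closed[OF c(3)] by blast
  then show ?thesis
    using is_sup_least[OF gen_cu_mor_sup[OF cu_mor_gen[OF \<alpha>] c(3,2)]
      gen_cu_mor_closed[OF cu_mor_gen[OF \<beta>] a]] by blast
qed

lemma cu_mor_ihom_eqI:
  assumes S: "cu_semigroup S" and \<alpha>: "\<alpha> \<in> cu_mor S (ihom T P)" and \<beta>: "\<beta> \<in> cu_mor S (ihom T P)"
    and eq: "\<And>a b. a \<in> carrier S \<Longrightarrow> b \<in> carrier T \<Longrightarrow> endpoint T P (\<alpha> a) b = endpoint T P (\<beta> a) b"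
  shows "\<alpha> = \<beta>"
proof (rule extensionalityI[OF cu_mor_extensional[OF \<alpha>] cu_mor_extensional[OF \<beta>]])
  fix a assume a: "a \<in> carrier S"
  note cl = gen_cu_mor_closed[OF cu_mor_gen[OF \<alpha>] a] gen_cu_mor_closed[OF cu_mor_gen[OF \<beta>] a]
  have refl: "endpoint T P (\<beta> a) b \<preceq>\<^bsub>P\<^esub> endpoint T P (\<beta> a) b"
    if "a \<in> carrier S" "b \<in> carrier T" for a b
    using P.le_refl endpoint_closed gen_cu_mor_closed[OF cu_mor_gen[OF \<beta>]] that by simp
  show "\<alpha> a = \<beta> a"
    using ihom_le_antisym[OF cl cu_mor_ihom_le[OF S \<alpha> \<beta> _ a] cu_mor_ihom_le[OF S \<beta> \<alpha> _ a]]
      eq refl by simp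
qed

end

section \<open>Currying bimorphisms\<close>

context
  fixes S :: "'a pomonoid" and T :: "'b pomonoid" and P :: "'p pomonoid"
    and \<phi> :: "'a \<Rightarrow> 'b \<Rightarrow> 'p"
  assumes bim: "cu_bimorphism S T P \<phi>"
begin

lemma bimorphism_closed: "a \<in> carrier S \<Longrightarrow> b \<in> carrier T \<Longrightarrow> \<phi> a b \<in> carrier P"
  using bim unfolding cu_bimorphism_def by simp

lemma bimorphism_add_left:
  "\<lbrakk>a \<in> carrier S; a' \<in> carrier S; b \<in> carrier T\<rbrakk> \<Longrightarrow> \<phi> (a \<oplus>\<^bsub>S\<^esub> a') b = \<phi> a b \<oplus>\<^bsub>P\<^esub> \<phi> a' b"
  using bim unfolding cu_bimorphism_def by simp

lemma bimorphism_add_right: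
  "\<lbrakk>a \<in> carrier S; b \<in> carrier T; b' \<in> carrier T\<rbrakk> \<Longrightarrow> \<phi> a (b \<oplus>\<^bsub>T\<^esub> b') = \<phi> a b \<oplus>\<^bsub>P\<^esub> \<phi> a b'"
  using bim unfolding cu_bimorphism_def by simp

lemma bimorphism_zero_left: "b \<in> carrier T \<Longrightarrow> \<phi> \<zero>\<^bsub>S\<^esub> b = \<zero>\<^bsub>P\<^esub>"
  using bim unfolding cu_bimorphism_def by simp

lemma bimorphism_zero_right: "a \<in> carrier S \<Longrightarrow> \<phi> a \<zero>\<^bsub>T\<^esub> = \<zero>\<^bsub>P\<^esub>"
  using bim unfolding cu_bimorphism_def by simp

lemma bimorphism_mono_left:
  "\<lbrakk>a \<in> carrier S; a' \<in> carrier S; b \<in> carrier T; a \<preceq>\<^bsub>S\<^esub> a'\<rbrakk> \<Longrightarrow> \<phi> a b \<preceq>\<^bsub>P\<^esub> \<phi> a' b"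
  using bim unfolding cu_bimorphism_def by simp

lemma bimorphism_mono_right:
  "\<lbrakk>a \<in> carrier S; b \<in> carrier T; b' \<in> carrier T; b \<preceq>\<^bsub>T\<^esub> b'\<rbrakk> \<Longrightarrow> \<phi> a b \<preceq>\<^bsub>P\<^esub> \<phi> a b'"
  using bim unfolding cu_bimorphism_def by simp

lemma bimorphism_sup:
  assumes "increasing S c" "increasing T d" "is_sup S (range c) x" "is_sup T (range d) y"
  shows "is_sup P (range (\<lambda>k. \<phi> (c k) (d k))) (\<phi> x y)"
  using bim assms unfolding cu_bimorphism_def by blast

lemma bimorphism_way_below: "a' \<lless>\<^bsub>S\<^esub> a \<Longrightarrow> b' \<lless>\<^bsub>T\<^esub> b \<Longrightarrow> \<phi> a' b' \<lless>\<^bsub>P\<^esub> \<phi> a b"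
  using bim unfolding cu_bimorphism_def by blast

end

text \<open>The source of the bimorphisms that induce both \<open>tensor_map\<close> and
  \<open>adj\<close>.\<close>

lemma bimorphism_precomp:
  assumes bim: "cu_bimorphism S' T' P \<phi>" and f: "f \<in> cu_mor S S'" and g: "g \<in> cu_mor T T'"
  shows "cu_bimorphism S T P (\<lambda>a b. \<phi> (f a) (g b))"
proof -
  note fg = cu_mor_gen[OF f] and gg = cu_mor_gen[OF g]
  have "is_sup P (range (\<lambda>k. \<phi> (f (c k)) (g (d k)))) (\<phi> (f x) (g y))"
    if "increasing S c" "increasing T d" "is_sup S (range c) x" "is_sup T (range d) y" for c d x y
    using bimorphism_sup[OF bim gen_cu_mor_increasing[OF fg] gen_cu_mor_increasing[OF gg]
        gen_cu_mor_sup[OF fg] gen_cu_mor_sup[OF gg]] that by blast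
  moreover have "\<phi> (f a') (g b') \<lless>\<^bsub>P\<^esub> \<phi> (f a) (g b)" if "a' \<lless>\<^bsub>S\<^esub> a" "b' \<lless>\<^bsub>T\<^esub> b" for a' a b' b
    using bimorphism_way_below[OF bim cu_mor_way_below[OF f] cu_mor_way_below[OF g]] that by blast
  ultimately show ?thesis
    unfolding cu_bimorphism_def
    by (simp add: gen_cu_mor_closed[OF fg] gen_cu_mor_closed[OF gg] gen_cu_mor_add[OF fg]
        gen_cu_mor_add[OF gg] gen_cu_mor_zero[OF fg] gen_cu_mor_zero[OF gg]
        gen_cu_mor_mono[OF fg] gen_cu_mor_mono[OF gg] bimorphism_closed[OF bim]
        bimorphism_add_left[OF bim] bimorphism_add_right[OF bim] bimorphism_zero_left[OF bim]
        bimorphism_zero_right[OF bim] bimorphism_mono_left[OF bim] bimorphism_mono_right[OF bim])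
qed

lemma bimorphism_increasing:
  assumes bim: "cu_bimorphism S T P \<phi>" and P: "positively_ordered_semigroup P"
    and c: "increasing S c" and d: "increasing T d"
  shows "increasing P (\<lambda>k. \<phi> (c k) (d k))"
proof -
  interpret P: positively_ordered_semigroup P by fact
  note cl = increasing_closed[OF c] increasing_closed[OF d]
  have "\<phi> (c k) (d k) \<preceq>\<^bsub>P\<^esub> \<phi> (c (Suc k)) (d (Suc k))" for k
    using P.le_trans[OF bimorphism_closed[OF bim] bimorphism_closed[OF bim] bimorphism_closed[OF bim]
        bimorphism_mono_left[OF bim] bimorphism_mono_right[OF bim]] cl c d
    unfolding increasing_def by blast
  then show ?thesis by (simp add: increasing_def bimorphism_closed[OF bim] cl)
qed

text \<open>Restricts a Cu-morphism on a tensor product to elementary tensors; uniqueness and the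
  surjectivity of \<open>adj\<close> both start from this.\<close>

lemma bimorphism_postcomp:
  assumes bim: "cu_bimorphism S T X \<phi>" and h: "h \<in> cu_mor X P" and X: "positively_ordered_semigroup X"
  shows "cu_bimorphism S T P (\<lambda>a b. h (\<phi> a b))"
proof -
  note hg = cu_mor_gen[OF h]
  have "is_sup P (range (\<lambda>k. h (\<phi> (c k) (d k)))) (h (\<phi> x y))"
    if "increasing S c" "increasing T d" "is_sup S (range c) x" "is_sup T (range d) y" for c d x y
    using gen_cu_mor_sup[OF hg bimorphism_increasing[OF bim X that(1,2)] bimorphism_sup[OF bim that]] .
  moreover have "h (\<phi> a' b') \<lless>\<^bsub>P\<^esub> h (\<phi> a b)" if "a' \<lless>\<^bsub>S\<^esub> a" "b' \<lless>\<^bsub>T\<^esub> b" for a' a b' b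
    using cu_mor_way_below[OF h bimorphism_way_below[OF bim that]] .
  ultimately show ?thesis
    unfolding cu_bimorphism_def
    by (simp add: gen_cu_mor_closed[OF hg] gen_cu_mor_add[OF hg] gen_cu_mor_zero[OF hg]
        gen_cu_mor_mono[OF hg] bimorphism_closed[OF bim]
        bimorphism_add_left[OF bim] bimorphism_add_right[OF bim] bimorphism_zero_left[OF bim]
        bimorphism_zero_right[OF bim] bimorphism_mono_left[OF bim] bimorphism_mono_right[OF bim])
qed

section \<open>Rational paths in a Cu-semigroup that increase strictly with respect to
  \<open>\<lless>\<close>\<close>

definition way_below_path :: "'a pomonoid \<Rightarrow> 'a \<Rightarrow> (rat \<Rightarrow> 'a) \<Rightarrow> bool" where
  "way_below_path S a p \<longleftrightarrow> (\<forall>l\<in>I_Q. \<forall>m\<in>I_Q. l < m \<longrightarrow> p l \<lless>\<^bsub>S\<^esub> p m) \<and>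
     is_sup S (range (\<lambda>n. p (I_Q_seq n))) a"

lemma way_below_path_less:
  "\<lbrakk>way_below_path S a p; l \<in> I_Q; m \<in> I_Q; l < m\<rbrakk> \<Longrightarrow> p l \<lless>\<^bsub>S\<^esub> p m"
  by (auto simp: way_below_path_def)

lemma way_below_path_sup: "way_below_path S a p \<Longrightarrow> is_sup S (range (\<lambda>n. p (I_Q_seq n))) a"
  by (simp add: way_below_path_def)

context cu_semigroup
begin

text \<open>\<open>\<lless>\<close> is transitive and interpolative, so \<open>I_Q_chain\<close>
  applies directly to a chain from (O2), and mutual cofinality keeps the supremum. It is recorded
  along \<open>I_Q_seq\<close> because (O4) and bimorphisms take sequences.\<close>

lemma way_below_path_exists:
  assumes "a \<in> carrier S"
  shows "\<exists>p. way_below_path S a p"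
proof -
  obtain c where c: "\<And>n. c n \<lless> c (Suc n)" "is_sup S (range c) a" using way_below_chain[OF assms] by blast
  have tr: "transp (way_below S)" using way_below_trans by (auto intro: transpI)
  have interp: "\<forall>x y. x \<lless> y \<longrightarrow> (\<exists>z. x \<lless> z \<and> z \<lless> y)" using way_below_interpolate by metis
  have chain: "\<forall>n. c n \<lless> c (Suc n)" using c(1) by blast
  obtain p where p: "\<And>l m. l \<in> I_Q \<Longrightarrow> m \<in> I_Q \<Longrightarrow> l < m \<Longrightarrow> p l \<lless> p m"
    "\<And>l. l \<in> I_Q \<Longrightarrow> \<exists>n. p l \<lless> c n" "\<And>n. \<exists>l\<in>I_Q. c n \<lless> p l"
    using I_Q_chain[OF tr interp chain] by blast
  have "is_sup S (range (\<lambda>n. p (I_Q_seq n))) a"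
  proof (rule is_sup_range_cofinal[OF c(2)])
    show "range (\<lambda>n. p (I_Q_seq n)) \<subseteq> carrier S"
      using p(2)[OF I_Q_seq_in] by (auto simp: way_below_def)
    fix x assume "x \<in> range c"
    then obtain n where n: "x = c n" by blast
    obtain l where l: "l \<in> I_Q" "x \<lless> p l" using p(3)[of n] n by blast
    then obtain k where "l < I_Q_seq k" using I_Q_seq_cofinal by auto
    then have "x \<lless> p (I_Q_seq k)" using l p(1)[OF l(1) I_Q_seq_in] way_below_trans by blast
    then show "\<exists>y\<in>range (\<lambda>n. p (I_Q_seq n)). x \<preceq> y" using way_below_le by blast
  next
    fix y assume "y \<in> range (\<lambda>n. p (I_Q_seq n))"
    then obtain n where "y = p (I_Q_seq n)" by blast
    then show "\<exists>x\<in>range c. y \<preceq> x" using p(2)[OF I_Q_seq_in[of n]] way_below_le by blast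
  qed
  then show ?thesis using p(1) unfolding way_below_path_def by blast
qed

context
  fixes a p
  assumes p: "way_below_path S a p"
begin

lemma way_below_path_in:
  assumes "l \<in> I_Q"
  shows "p l \<in> carrier S"
proof -
  obtain m where "m \<in> I_Q" "l < m" using I_Q_above[OF assms] .
  then show ?thesis using way_below_path_less[OF p assms] way_below_closed(1) by metis
qed

lemma way_below_path_increasing: "increasing S (\<lambda>n. p (I_Q_seq n))"
  using way_below_path_in[OF I_Q_seq_in] way_below_le
    way_below_path_less[OF p I_Q_seq_in I_Q_seq_in I_Q_seq_less]
  by (simp add: increasing_def)

lemma way_below_path_below:
  assumes l: "l \<in> I_Q"
  shows "p l \<lless> a"
proof -
  obtain n where "l < I_Q_seq n" using I_Q_seq_cofinal l by auto
  then have "p l \<lless> p (I_Q_seq n)" using way_below_path_less[OF p l I_Q_seq_in] by blast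
  moreover have "p (I_Q_seq n) \<preceq> a" using is_sup_upper[OF way_below_path_sup[OF p]] by blast
  ultimately show ?thesis using way_below_le_trans is_sup_closed[OF way_below_path_sup[OF p]] by blast
qed

lemma way_below_path_cofinal:
  assumes x: "x \<lless> a"
  obtains l where "l \<in> I_Q" "x \<lless> p l"
proof -
  obtain n where n: "x \<preceq> p (I_Q_seq n)"
    using way_belowD[OF x way_below_path_increasing way_below_path_sup[OF p]]
      le_refl way_below_closed(2)[OF x] by blast
  \<comment> \<open>One index further along the path turns \<open>\<preceq>\<close> into
    \<open>\<lless>\<close>.\<close>
  have "x \<lless> p (I_Q_seq (Suc n))"
    using le_way_below[OF n way_below_path_less[OF p I_Q_seq_in I_Q_seq_in I_Q_seq_less]]
      way_below_closed(1)[OF x] by blast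
  then show thesis using that I_Q_seq_in by blast
qed

end

text \<open>Makes currying additive: the sum of paths chosen for a and b is an admissible choice for
  the sum.\<close>

lemma way_below_path_add:
  assumes p: "way_below_path S a p" and q: "way_below_path S b q"
  shows "way_below_path S (a \<oplus> b) (\<lambda>l. p l \<oplus> q l)"
  using O3[OF way_below_path_less[OF p] way_below_path_less[OF q]]
    O4[OF way_below_path_increasing[OF p] way_below_path_increasing[OF q]
      way_below_path_sup[OF p] way_below_path_sup[OF q]]
  unfolding way_below_path_def by blast

lemma way_below_path_zero: "way_below_path S \<zero> (\<lambda>_. \<zero>)"
  using is_sup_const[OF zero_closed]
  by (auto simp: way_below_path_def way_below_def zero_closed zero_le increasing_closed)

end

section \<open>Currying a bimorphism into the internal hom\<close>

definition bim_path :: "'b pomonoid \<Rightarrow> ('a \<Rightarrow> 'b \<Rightarrow> 'p) \<Rightarrow> (rat \<Rightarrow> 'a) \<Rightarrow> rat \<Rightarrow> 'b \<Rightarrow> 'p" where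
  "bim_path T \<phi> p = (\<lambda>l\<in>I_Q. \<lambda>b\<in>carrier T. \<phi> (p l) b)"

text \<open>The choice of p does not affect the class; see \<open>cu_curry_eq\<close>, through which
  all properties are derived.\<close>

definition cu_curry ::
    "'a pomonoid \<Rightarrow> 'b pomonoid \<Rightarrow> 'p pomonoid \<Rightarrow> ('a \<Rightarrow> 'b \<Rightarrow> 'p) \<Rightarrow> 'a \<Rightarrow> (rat \<Rightarrow> 'b \<Rightarrow> 'p) set" where
  "cu_curry S T P \<phi> =
     (\<lambda>a\<in>carrier S. path_class T P (bim_path T \<phi> (SOME p. way_below_path S a p)))"

locale cu_bim = cu_pair T P + S: cu_semigroup S
  for S :: "'a pomonoid" and T :: "'b pomonoid" and P :: "'p pomonoid" +
  fixes \<phi> :: "'a \<Rightarrow> 'b \<Rightarrow> 'p"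
  assumes bim: "cu_bimorphism S T P \<phi>"
begin

text \<open>A constant sequence in the first variable reduces this to joint continuity. The map is
  only a generalized Cu-morphism, since a need not be way below itself; this is why a whole path of
  sections has to represent a.\<close>

lemma section_gen:
  assumes a: "a \<in> carrier S"
  shows "(\<lambda>b\<in>carrier T. \<phi> a b) \<in> gen_cu_mor T P"
proof -
  have "is_sup P (range (\<lambda>n. (\<lambda>b\<in>carrier T. \<phi> a b) (c n))) ((\<lambda>b\<in>carrier T. \<phi> a b) s)"
    if c: "increasing T c" "is_sup T (range c) s" for c s
    using bimorphism_sup[OF bim S.increasing_const[OF a] c(1) S.is_sup_const[OF a] c(2)] c
    by (simp add: increasing_closed is_sup_closed)
  then show ?thesis
    using a by (auto simp: gen_cu_mor_def bimorphism_closed[OF bim] T.add_closed T.zero_closed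
        bimorphism_add_right[OF bim] bimorphism_zero_right[OF bim] bimorphism_mono_right[OF bim])
qed

lemma bim_path_prec:
  "p l \<lless>\<^bsub>S\<^esub> q m \<Longrightarrow> l \<in> I_Q \<Longrightarrow> m \<in> I_Q \<Longrightarrow> bim_path T \<phi> p l \<sqsubset> bim_path T \<phi> q m"
  using bimorphism_way_below[OF bim]
  by (auto simp: mor_prec_def bim_path_def way_below_closed)

lemma bim_path_in:
  assumes p: "way_below_path S a p"
  shows "bim_path T \<phi> p \<in> cu_paths T P"
proof -
  have "bim_path T \<phi> p l \<in> gen_cu_mor T P" if "l \<in> I_Q" for l
    using section_gen[OF S.way_below_path_in[OF p that]] that by (simp add: bim_path_def)
  moreover have "bim_path T \<phi> p \<in> extensional I_Q" by (simp add: bim_path_def)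
  ultimately show ?thesis
    using bim_path_prec way_below_path_less[OF p] by (auto simp: cu_paths_def PiE_def)
qed

text \<open>Each \<open>p l\<close> is way below a, hence way below b, and is therefore overtaken by
  the path q.\<close>

lemma bim_path_le:
  assumes p: "way_below_path S a p" and q: "way_below_path S b q" and ab: "a \<preceq>\<^bsub>S\<^esub> b"
  shows "path_le T P (bim_path T \<phi> p) (bim_path T \<phi> q)"
  unfolding path_le_def
proof
  fix l assume l: "l \<in> I_Q"
  have "p l \<lless>\<^bsub>S\<^esub> b"
    using S.way_below_le_trans[OF S.way_below_path_below[OF p l] ab is_sup_closed[OF way_below_path_sup[OF q]]] .
  then obtain m where m: "m \<in> I_Q" "p l \<lless>\<^bsub>S\<^esub> q m" by (rule S.way_below_path_cofinal[OF q])
  then show "\<exists>m\<in>I_Q. bim_path T \<phi> p l \<sqsubset> bim_path T \<phi> q m" using bim_path_prec[OF _ l] by blast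
qed

lemma cu_curry_eq:
  assumes p: "way_below_path S a p"
  shows "cu_curry S T P \<phi> a = path_class T P (bim_path T \<phi> p)"
proof -
  have a: "a \<in> carrier S" using is_sup_closed[OF way_below_path_sup[OF p]] .
  have q: "way_below_path S a (SOME p. way_below_path S a p)" using someI[of "way_below_path S a", OF p] .
  show ?thesis
    using bim_path_le[OF p q] bim_path_le[OF q p] S.le_refl[OF a] a
    by (simp add: cu_curry_def path_class_eq_iff[OF bim_path_in[OF q] bim_path_in[OF p]])
qed

text \<open>Currying inverts evaluation: the endpoint is the supremum of \<phi>(p l, b), and \<phi>
  is continuous along p with b held constant.\<close>

lemma endpoint_cu_curry:
  assumes a: "a \<in> carrier S" and b: "b \<in> carrier T"
  shows "endpoint T P (cu_curry S T P \<phi> a) b = \<phi> a b"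
proof -
  obtain p where p: "way_below_path S a p" using S.way_below_path_exists[OF a] by blast
  have "is_sup P (range (\<lambda>n. bim_path T \<phi> p (I_Q_seq n) b)) (\<phi> a b)"
    using bimorphism_sup[OF bim S.way_below_path_increasing[OF p] T.increasing_const[OF b]
        way_below_path_sup[OF p] T.is_sup_const[OF b]] b I_Q_seq_in
    by (simp add: bim_path_def)
  then show ?thesis
    using P.is_sup_unique[OF path_endpoint_sup(2)[OF bim_path_in[OF p] b]]
    by (simp add: cu_curry_eq[OF p] endpoint_class[OF bim_path_in[OF p]])
qed

lemma cu_curry_mono:
  assumes a: "a \<in> carrier S" "b \<in> carrier S" "a \<preceq>\<^bsub>S\<^esub> b"
  shows "cu_curry S T P \<phi> a \<preceq>\<^bsub>ihom T P\<^esub> cu_curry S T P \<phi> b"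
proof -
  obtain p q where p: "way_below_path S a p" and q: "way_below_path S b q"
    using S.way_below_path_exists a(1,2) by blast
  show ?thesis
    using bim_path_le[OF p q a(3)]
    by (simp add: cu_curry_eq[OF p] cu_curry_eq[OF q] ihom_le[OF bim_path_in[OF p] bim_path_in[OF q]])
qed

lemma cu_curry_closed:
  assumes a: "a \<in> carrier S"
  shows "cu_curry S T P \<phi> a \<in> carrier (ihom T P)"
proof -
  obtain p where p: "way_below_path S a p" using S.way_below_path_exists[OF a] by blast
  show ?thesis using path_class_carrier[OF bim_path_in[OF p]] by (simp add: cu_curry_eq[OF p])
qed

lemma cu_curry_add:
  assumes a: "a \<in> carrier S" "b \<in> carrier S"
  shows "cu_curry S T P \<phi> (a \<oplus>\<^bsub>S\<^esub> b) = cu_curry S T P \<phi> a \<oplus>\<^bsub>ihom T P\<^esub> cu_curry S T P \<phi> b"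
proof -
  obtain p q where p: "way_below_path S a p" and q: "way_below_path S b q"
    using S.way_below_path_exists a by blast
  have "path_add T P (bim_path T \<phi> p) (bim_path T \<phi> q) = bim_path T \<phi> (\<lambda>l. p l \<oplus>\<^bsub>S\<^esub> q l)"
    unfolding path_add_def bim_path_def
    using S.way_below_path_in[OF p] S.way_below_path_in[OF q]
    by (intro restrict_ext) (simp add: bimorphism_add_left[OF bim])
  then show ?thesis
    by (simp add: cu_curry_eq[OF p] cu_curry_eq[OF q] cu_curry_eq[OF S.way_below_path_add[OF p q]]
        ihom_add[OF bim_path_in[OF p] bim_path_in[OF q]])
qed

lemma cu_curry_zero: "cu_curry S T P \<phi> \<zero>\<^bsub>S\<^esub> = \<zero>\<^bsub>ihom T P\<^esub>"
proof -
  have "bim_path T \<phi> (\<lambda>_. \<zero>\<^bsub>S\<^esub>) = (\<lambda>l\<in>I_Q. \<lambda>a\<in>carrier T. \<zero>\<^bsub>P\<^esub>)"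
    unfolding bim_path_def by (intro restrict_ext) (simp add: bimorphism_zero_left[OF bim])
  then show ?thesis by (simp add: cu_curry_eq[OF S.way_below_path_zero] ihom_zero)
qed

lemma cu_curry_sup:
  assumes c: "increasing S c" and s: "is_sup S (range c) s"
  shows "is_sup (ihom T P) (range (\<lambda>n. cu_curry S T P \<phi> (c n))) (cu_curry S T P \<phi> s)"
proof -
  have "\<forall>n. \<exists>p. way_below_path S (c n) p"
    using S.way_below_path_exists increasing_closed[OF c] by blast
  then obtain p where p: "\<And>n. way_below_path S (c n) (p n)" by metis
  obtain q where q: "way_below_path S s q" using S.way_below_path_exists[OF is_sup_closed[OF s]] by blast
  have upper: "path_le T P (bim_path T \<phi> (p n)) (bim_path T \<phi> q)" for n
    using bim_path_le[OF p q] is_sup_upper[OF s] by blast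
  have "\<exists>n. \<exists>m\<in>I_Q. bim_path T \<phi> q l \<sqsubset> bim_path T \<phi> (p n) m" if l: "l \<in> I_Q" for l
  proof -
    \<comment> \<open>From \<open>q k\<close> \<open>\<lless>\<close> s one only gets
      \<open>q k\<close> \<open>\<preceq>\<close> \<open>c n\<close>; the smaller index l restores
      \<open>\<lless>\<close>.\<close>
    obtain k where k: "k \<in> I_Q" "l < k" using I_Q_above[OF l] .
    obtain n where n: "q k \<preceq>\<^bsub>S\<^esub> c n"
      using way_belowD[OF S.way_below_path_below[OF q k(1)] c s] S.le_refl[OF is_sup_closed[OF s]] by blast
    have "q l \<lless>\<^bsub>S\<^esub> c n"
      using S.way_below_le_trans[OF way_below_path_less[OF q l k] n increasing_closed[OF c]] .
    then obtain m where "m \<in> I_Q" "q l \<lless>\<^bsub>S\<^esub> p n m" by (rule S.way_below_path_cofinal[OF p])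
    then show ?thesis using bim_path_prec[OF _ l] by blast
  qed
  then show ?thesis
    using ihom_is_supI[of "\<lambda>n. bim_path T \<phi> (p n)", OF bim_path_in[OF p] bim_path_in[OF q] upper]
    by (simp add: cu_curry_eq[OF p] cu_curry_eq[OF q])
qed

text \<open>The path q to a overtakes a' at some l. As every \<open>p m\<close> is way below a', the
  single section at \<open>q l\<close> bounds the entire path of a', which is the criterion
  \<open>ihom_way_below_iff\<close>.\<close>

lemma cu_curry_way_below:
  assumes ab: "a' \<lless>\<^bsub>S\<^esub> a"
  shows "cu_curry S T P \<phi> a' \<lless>\<^bsub>ihom T P\<^esub> cu_curry S T P \<phi> a"
proof -
  obtain p q where p: "way_below_path S a' p" and q: "way_below_path S a q"
    using S.way_below_path_exists way_below_closed[OF ab] by blast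
  obtain l where l: "l \<in> I_Q" "a' \<lless>\<^bsub>S\<^esub> q l" using S.way_below_path_cofinal[OF q ab] .
  have "bim_path T \<phi> p m \<sqsubset> bim_path T \<phi> q l" if "m \<in> I_Q" for m
    using bim_path_prec[of p m q l] S.way_below_trans[OF S.way_below_path_below[OF p that] l(2)] that l(1)
    by blast
  then show ?thesis
    using l(1) ihom_way_below_iff[OF bim_path_in[OF p] bim_path_in[OF q]]
    unfolding cu_curry_eq[OF p] cu_curry_eq[OF q] by blast
qed

lemma cu_curry_mor: "cu_curry S T P \<phi> \<in> cu_mor S (ihom T P)"
  unfolding cu_mor_def gen_cu_mor_def
  using cu_curry_closed cu_curry_add cu_curry_zero cu_curry_mono cu_curry_sup cu_curry_way_below
  by (auto simp: PiE_def) (simp add: cu_curry_def)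

end

section \<open>Functoriality of the internal hom\<close>

text \<open>The qualifiers \<open>X\<close> and \<open>P\<close> name the pairs (T, X) and (T, P);
  the semigroup P itself is reached as \<open>P.P\<close>.\<close>

locale cu_push = X: cu_pair T X + P: cu_pair T P
  for T :: "'b pomonoid" and X :: "'x pomonoid" and P :: "'p pomonoid" +
  fixes g :: "'x \<Rightarrow> 'p"
  assumes g: "g \<in> cu_mor X P"
begin

definition push :: "(rat \<Rightarrow> 'b \<Rightarrow> 'x) \<Rightarrow> rat \<Rightarrow> 'b \<Rightarrow> 'p" where
  "push f = (\<lambda>l\<in>I_Q. compose (carrier T) g (f l))"

lemma push_apply: "l \<in> I_Q \<Longrightarrow> b \<in> carrier T \<Longrightarrow> push f l b = g (f l b)"
  by (simp add: push_def compose_def)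

text \<open>Preservation of \<open>\<lless>\<close> by g is what lets g act on paths; the facts
  below on order, suprema and \<open>\<lless>\<close> rest on this.\<close>

lemma push_prec:
  "\<lbrakk>X.prec (f l) (h m); l \<in> I_Q; m \<in> I_Q\<rbrakk> \<Longrightarrow> P.prec (push f l) (push h m)"
  using cu_mor_way_below[OF g]
  by (simp add: mor_prec_def push_apply way_below_closed)

lemma push_in:
  assumes f: "f \<in> cu_paths T X"
  shows "push f \<in> cu_paths T P"
proof -
  have "push f l \<in> gen_cu_mor T P" if "l \<in> I_Q" for l
    using gen_cu_mor_compose[OF X.path_gen[OF f that] cu_mor_gen[OF g] X.T.positively_ordered_semigroup_axioms] that
    by (simp add: push_def)
  moreover have "push f \<in> extensional I_Q" by (simp add: push_def)
  ultimately show ?thesis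
    using push_prec[where f = f and h = f] X.path_prec[OF f] by (auto simp: cu_paths_def PiE_def)
qed

lemma push_le:
  assumes "path_le T X f h"
  shows "path_le T P (push f) (push h)"
  using assms push_prec[of f _ h] unfolding path_le_def by meson

lemma ihom_push_class:
  assumes f: "f \<in> cu_paths T X"
  shows "ihom_push T X P g (path_class T X f) = path_class T P (push f)"
proof -
  have "path_class T P (push h) = path_class T P (push f)" if "h \<in> path_class T X f" for h
    using that by (simp add: X.path_class_iff P.path_class_eq_iff push_in push_le)
  moreover have "path_class T X f \<noteq> {}" using X.path_class_in[OF f] by blast
  ultimately show ?thesis
    using X.path_class_carrier[OF f]
    by (simp add: ihom_push_def flip: push_def cong: SUP_cong)
qed

lemma push_path_add:
  assumes f: "f \<in> cu_paths T X" and h: "h \<in> cu_paths T X"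
  shows "push (path_add T X f h) = path_add T P (push f) (push h)"
  unfolding push_def path_add_def
  by (intro restrict_ext ext)
    (auto simp: compose_def gen_cu_mor_add[OF cu_mor_gen[OF g]] X.path_closed[OF f] X.path_closed[OF h]
      intro!: restrict_ext)

lemma push_zero: "push (\<lambda>l\<in>I_Q. \<lambda>a\<in>carrier T. \<zero>\<^bsub>X\<^esub>) = (\<lambda>l\<in>I_Q. \<lambda>a\<in>carrier T. \<zero>\<^bsub>P\<^esub>)"
  unfolding push_def
  by (intro restrict_ext) (auto simp: compose_def gen_cu_mor_zero[OF cu_mor_gen[OF g]] intro!: restrict_ext)

text \<open>Suprema in \<open>ihom\<close> are characterised by cofinality with respect to
  \<open>mor_prec\<close>, and \<open>push\<close> respects that relation.\<close>

lemma ihom_push_sup: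
  assumes F: "increasing (ihom T X) F" "is_sup (ihom T X) (range F) G"
  shows "is_sup (ihom T P) (range (\<lambda>n. ihom_push T X P g (F n))) (ihom_push T X P g G)"
proof -
  obtain f where f: "\<And>n. f n \<in> cu_paths T X" "\<And>n. F n = path_class T X (f n)"
    "\<And>n. path_le T X (f n) (f (Suc n))" using X.ihom_increasing_rep[OF F(1)] by metis
  obtain h where h: "h \<in> cu_paths T X" "G = path_class T X h"
    using X.ihom_carrierE[OF is_sup_closed[OF F(2)]] .
  have "F = (\<lambda>n. path_class T X (f n))" using f(2) by blast
  then have sup: "is_sup (ihom T X) (range (\<lambda>n. path_class T X (f n))) (path_class T X h)"
    using F(2) h(2) by simp
  have "path_class T X (f n) \<preceq>\<^bsub>ihom T X\<^esub> path_class T X h" for n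
    using is_sup_upper[OF sup] by blast
  then have "path_le T X (f n) h" for n using X.ihom_le[OF f(1) h(1)] by blast
  then have upper: "path_le T P (push (f n)) (push h)" for n by (rule push_le)
  have "\<exists>n. \<exists>m\<in>I_Q. P.prec (push h l) (push (f n) m)" if l: "l \<in> I_Q" for l
  proof -
    obtain n m where "m \<in> I_Q" "X.prec (h l) (f n m)"
      using X.ihom_sup_cofinal[of f, OF f(1,3) h(1) sup l] by blast
    then show ?thesis using push_prec[of h l "f n" m] l by blast
  qed
  then show ?thesis
    using P.ihom_is_supI[of "\<lambda>n. push (f n)", OF push_in[OF f(1)] push_in[OF h(1)] upper]
    by (simp add: f h(2) ihom_push_class[OF f(1)] ihom_push_class[OF h(1)])
qed

lemma ihom_push_way_below:
  assumes F: "F \<lless>\<^bsub>ihom T X\<^esub> G"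
  shows "ihom_push T X P g F \<lless>\<^bsub>ihom T P\<^esub> ihom_push T X P g G"
proof -
  obtain f where f: "f \<in> cu_paths T X" "F = path_class T X f"
      using X.ihom_carrierE[OF way_below_closed(1)[OF F]] .
    obtain h where h: "h \<in> cu_paths T X" "G = path_class T X h"
      using X.ihom_carrierE[OF way_below_closed(2)[OF F]] .
  obtain l where l: "l \<in> I_Q" "\<And>m. m \<in> I_Q \<Longrightarrow> X.prec (f m) (h l)"
    using F X.ihom_way_below_iff[OF f(1) h(1)] f(2) h(2) by blast
  then have "\<forall>m\<in>I_Q. P.prec (push f m) (push h l)" using push_prec by blast
  then show ?thesis
    using P.ihom_way_below_iff[OF push_in[OF f(1)] push_in[OF h(1)]] l(1)
    by (auto simp: f(2) h(2) ihom_push_class[OF f(1)] ihom_push_class[OF h(1)])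
qed

lemma ihom_push_mor: "ihom_push T X P g \<in> cu_mor (ihom T X) (ihom T P)"
proof -
  have "ihom_push T X P g F \<in> carrier (ihom T P)" if "F \<in> carrier (ihom T X)" for F
  proof -
    obtain f where f: "f \<in> cu_paths T X" "F = path_class T X f" using X.ihom_carrierE[OF \<open>F \<in> carrier (ihom T X)\<close>] .
    then show ?thesis using ihom_push_class[OF f(1)] P.path_class_carrier[OF push_in[OF f(1)]] by simp
  qed
  moreover have "ihom_push T X P g (F \<oplus>\<^bsub>ihom T X\<^esub> G) = ihom_push T X P g F \<oplus>\<^bsub>ihom T P\<^esub> ihom_push T X P g G"
    if FG: "F \<in> carrier (ihom T X)" "G \<in> carrier (ihom T X)" for F G
  proof -
    obtain f where f: "f \<in> cu_paths T X" "F = path_class T X f"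
      using X.ihom_carrierE[OF FG(1)] .
    obtain h where h: "h \<in> cu_paths T X" "G = path_class T X h"
      using X.ihom_carrierE[OF FG(2)] .
    show ?thesis
      by (simp add: f(2) h(2) ihom_push_class[OF f(1)] ihom_push_class[OF h(1)]
          X.ihom_add[OF f(1) h(1)] P.ihom_add[OF push_in[OF f(1)] push_in[OF h(1)]]
          ihom_push_class[OF X.path_add_closed[OF f(1) h(1)]] push_path_add[OF f(1) h(1)])
  qed
  moreover have "ihom_push T X P g \<zero>\<^bsub>ihom T X\<^esub> = \<zero>\<^bsub>ihom T P\<^esub>"
    by (simp add: X.ihom_zero P.ihom_zero ihom_push_class[OF X.path_zero] push_zero)
  moreover have "ihom_push T X P g F \<preceq>\<^bsub>ihom T P\<^esub> ihom_push T X P g G"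
    if FG: "F \<in> carrier (ihom T X)" "G \<in> carrier (ihom T X)" "F \<preceq>\<^bsub>ihom T X\<^esub> G" for F G
  proof -
    obtain f where f: "f \<in> cu_paths T X" "F = path_class T X f"
      using X.ihom_carrierE[OF FG(1)] .
    obtain h where h: "h \<in> cu_paths T X" "G = path_class T X h"
      using X.ihom_carrierE[OF FG(2)] .
    show ?thesis
      using FG(3) push_le
      by (simp add: f(2) h(2) ihom_push_class[OF f(1)] ihom_push_class[OF h(1)]
          X.ihom_le[OF f(1) h(1)] P.ihom_le[OF push_in[OF f(1)] push_in[OF h(1)]])
  qed
  moreover have "ihom_push T X P g \<in> extensional (carrier (ihom T X))"
    by (simp add: ihom_push_def)
  ultimately show ?thesis
    unfolding cu_mor_def gen_cu_mor_def
    using ihom_push_sup ihom_push_way_below by (simp add: PiE_def)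
qed

text \<open>Naturality of the endpoint map: g preserves the supremum along
  \<open>I_Q_seq\<close>.\<close>

lemma endpoint_ihom_push:
  assumes F: "F \<in> carrier (ihom T X)" and b: "b \<in> carrier T"
  shows "endpoint T P (ihom_push T X P g F) b = g (endpoint T X F b)"
proof -
  obtain f where f: "f \<in> cu_paths T X" "F = path_class T X f" using X.ihom_carrierE[OF F] .
  have "is_sup P (range (\<lambda>n. push f (I_Q_seq n) b)) (g (path_endpoint T X f b))"
    using gen_cu_mor_sup[OF cu_mor_gen[OF g] X.path_endpoint_sup(3,2)[OF f(1) b]]
    by (simp add: push_apply[OF I_Q_seq_in b])
  then show ?thesis
    using P.P.is_sup_unique[OF P.path_endpoint_sup(2)[OF push_in[OF f(1)] b]]
    by (simp add: f(2) ihom_push_class[OF f(1)] P.endpoint_class[OF push_in[OF f(1)]]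
        X.endpoint_class[OF f(1)])
qed

end

section \<open>The adjunction\<close>

lemma cu_tensor_cu_semigroup: "is_cu_tensor S T X t TYPE('p) \<Longrightarrow> cu_semigroup X"
  by (simp add: is_cu_tensor_def)

lemma cu_tensor_bimorphism: "is_cu_tensor S T X t TYPE('p) \<Longrightarrow> cu_bimorphism S T X t"
  by (simp add: is_cu_tensor_def)

lemma cu_tensor_universal:
  fixes P :: "'p pomonoid"
  assumes "is_cu_tensor S T X t TYPE('p)" "cu_semigroup P" "cu_bimorphism S T P \<phi>"
  shows "\<exists>!\<gamma>. \<gamma> \<in> cu_mor X P \<and> (\<forall>a\<in>carrier S. \<forall>b\<in>carrier T. \<gamma> (t a b) = \<phi> a b)"
  using assms unfolding is_cu_tensor_def by blast

text \<open>Both morphisms factor the same bimorphism, the restriction of \<delta> to elementary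
  tensors, so uniqueness in the universal property applies.\<close>

lemma cu_tensor_eqI:
  fixes P :: "'p pomonoid"
  assumes X: "is_cu_tensor S T X t TYPE('p)" and P: "cu_semigroup P"
    and \<gamma>: "\<gamma> \<in> cu_mor X P" and \<delta>: "\<delta> \<in> cu_mor X P"
    and eq: "\<And>a b. a \<in> carrier S \<Longrightarrow> b \<in> carrier T \<Longrightarrow> \<gamma> (t a b) = \<delta> (t a b)"
  shows "\<gamma> = \<delta>"
proof -
  have "positively_ordered_semigroup X"
    using cu_tensor_cu_semigroup[OF X] by (rule cu_semigroup.axioms(1))
  then have "cu_bimorphism S T P (\<lambda>a b. \<delta> (t a b))"
    by (rule bimorphism_postcomp[OF cu_tensor_bimorphism[OF X] \<delta>])
  then show ?thesis using cu_tensor_universal[OF X P] \<gamma> \<delta> eq by blast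
qed

lemma tensor_map_spec:
  fixes Y :: "'y pomonoid"
  assumes X: "is_cu_tensor S T X t TYPE('y)" and Y: "cu_semigroup Y"
    and u: "cu_bimorphism S' T' Y u" and f: "f \<in> cu_mor S S'" and g: "g \<in> cu_mor T T'"
  shows "tensor_map S T X t Y u f g \<in> cu_mor X Y"
    and "\<lbrakk>a \<in> carrier S; b \<in> carrier T\<rbrakk> \<Longrightarrow> tensor_map S T X t Y u f g (t a b) = u (f a) (g b)"
  using theI'[OF cu_tensor_universal[OF X Y bimorphism_precomp[OF u f g]]]
  unfolding tensor_map_def by blast+

lemma adj_spec:
  fixes P :: "'p pomonoid"
  assumes T: "cu_semigroup T" and P: "cu_semigroup P"
    and X: "is_cu_tensor S T X t TYPE('p)" and \<alpha>: "\<alpha> \<in> cu_mor S (ihom T P)"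
  shows "adj S T P X t \<alpha> \<in> cu_mor X P"
    and "\<lbrakk>a \<in> carrier S; b \<in> carrier T\<rbrakk> \<Longrightarrow> adj S T P X t \<alpha> (t a b) = endpoint T P (\<alpha> a) b"
proof -
  interpret cu_pair T P using T P by (rule cu_pair.intro)
  \<comment> \<open>The identity on T is inserted to fit \<open>bimorphism_precomp\<close> and is
    removed again by the equivalence that follows.\<close>
  have bim: "cu_bimorphism S T P (\<lambda>a b. endpoint T P (\<alpha> a) (cu_id T b))"
    by (intro bimorphism_precomp[OF endpoint_bimorphism \<alpha>] cu_id_mor T.zero_closed T.add_closed)
  have id: "(\<forall>a\<in>carrier S. \<forall>b\<in>carrier T. \<gamma> (t a b) = endpoint T P (\<alpha> a) (cu_id T b)) \<longleftrightarrow>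
      (\<forall>a\<in>carrier S. \<forall>b\<in>carrier T. \<gamma> (t a b) = endpoint T P (\<alpha> a) b)" for \<gamma>
    by (simp add: cu_id_def)
  have "\<exists>!\<gamma>. \<gamma> \<in> cu_mor X P \<and> (\<forall>a\<in>carrier S. \<forall>b\<in>carrier T. \<gamma> (t a b) = endpoint T P (\<alpha> a) b)"
    using cu_tensor_universal[OF X P bim] unfolding id .
  from theI'[OF this] show "adj S T P X t \<alpha> \<in> cu_mor X P"
    and "\<lbrakk>a \<in> carrier S; b \<in> carrier T\<rbrakk> \<Longrightarrow> adj S T P X t \<alpha> (t a b) = endpoint T P (\<alpha> a) b"
    unfolding adj_def by blast+
qed

text \<open>\<open>adj\<close> records all endpoint values of \<alpha>, and these determine \<alpha>
  by \<open>cu_mor_ihom_eqI\<close>. A preimage of \<gamma> is obtained by currying its restriction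
  to elementary tensors.\<close>

lemma adj_bij_betw:
  fixes P :: "'p pomonoid"
  assumes S: "cu_semigroup S" and T: "cu_semigroup T" and P: "cu_semigroup P"
    and X: "is_cu_tensor S T X t TYPE('p)"
  shows "bij_betw (adj S T P X t) (cu_mor S (ihom T P)) (cu_mor X P)"
  unfolding bij_betw_def
proof (intro conjI inj_onI equalityI subsetI)
  interpret cu_pair T P using T P by (rule cu_pair.intro)
  note spec = adj_spec[OF T P X]
  fix \<alpha> \<beta> assume \<alpha>: "\<alpha> \<in> cu_mor S (ihom T P)" and \<beta>: "\<beta> \<in> cu_mor S (ihom T P)"
    and eq: "adj S T P X t \<alpha> = adj S T P X t \<beta>"
  show "\<alpha> = \<beta>"
    by (rule cu_mor_ihom_eqI[OF S \<alpha> \<beta>]) (metis eq spec(2)[OF \<alpha>] spec(2)[OF \<beta>])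
next
  fix \<gamma> assume "\<gamma> \<in> adj S T P X t ` cu_mor S (ihom T P)"
  then show "\<gamma> \<in> cu_mor X P" using adj_spec(1)[OF T P X] by blast
next
  fix \<gamma> assume \<gamma>: "\<gamma> \<in> cu_mor X P"
  define \<phi> where "\<phi> a b = \<gamma> (t a b)" for a b
  have "cu_bimorphism S T P \<phi>"
    unfolding \<phi>_def
    by (rule bimorphism_postcomp[OF cu_tensor_bimorphism[OF X] \<gamma>
          cu_semigroup.axioms(1)[OF cu_tensor_cu_semigroup[OF X]]])
  then interpret cu_bim S T P \<phi> using S T P by (intro cu_bim.intro cu_pair.intro cu_bim_axioms.intro)
  have "adj S T P X t (cu_curry S T P \<phi>) = \<gamma>"
    by (rule cu_tensor_eqI[OF X P adj_spec(1)[OF T P X cu_curry_mor] \<gamma>])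
      (simp add: adj_spec(2)[OF T P X cu_curry_mor] endpoint_cu_curry \<phi>_def)
  then show "\<gamma> \<in> adj S T P X t ` cu_mor S (ihom T P)" using cu_curry_mor by blast
qed

lemma adj_inv_spec:
  fixes P :: "'p pomonoid"
  assumes "cu_semigroup S" and T: "cu_semigroup T" and P: "cu_semigroup P"
    and X: "is_cu_tensor S T X t TYPE('p)" and \<gamma>: "\<gamma> \<in> cu_mor X P"
  shows "adj_inv S T P X t \<gamma> \<in> cu_mor S (ihom T P)" "adj S T P X t (adj_inv S T P X t \<gamma>) = \<gamma>"
proof -
  note bij = adj_bij_betw[OF assms(1-4)]
  have "the_inv_into (cu_mor S (ihom T P)) (adj S T P X t) \<gamma> \<in> cu_mor S (ihom T P)"
    using bij_betwE[OF bij_betw_the_inv_into[OF bij]] \<gamma> by blast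
  then show "adj_inv S T P X t \<gamma> \<in> cu_mor S (ihom T P)" by (simp add: adj_inv_def)
  show "adj S T P X t (adj_inv S T P X t \<gamma>) = \<gamma>"
    unfolding adj_inv_def using f_the_inv_into_f_bij_betw[OF bij] \<gamma> by blast
qed

lemma adj_inv_adj:
  fixes P :: "'p pomonoid"
  assumes "cu_semigroup S" "cu_semigroup T" "cu_semigroup P" "is_cu_tensor S T X t TYPE('p)"
    and "\<alpha> \<in> cu_mor S (ihom T P)"
  shows "adj_inv S T P X t (adj S T P X t \<alpha>) = \<alpha>"
  unfolding adj_inv_def using adj_bij_betw[OF assms(1-4)] assms(5)
  by (simp add: bij_betw_def the_inv_into_f_f)

text \<open>The universal property of X is assumed for three element types, one per kind of target:
  P for the bijection, X for the unit, and Y for the map induced by f and the identity of T.\<close>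

theorem proposition3p22:
  fixes S :: "'a pomonoid" and T :: "'b pomonoid" and P :: "'p pomonoid"
    and X :: "'x pomonoid" and t :: "'a \<Rightarrow> 'b \<Rightarrow> 'x"
    and Y :: "'y pomonoid" and u :: "(rat \<Rightarrow> 'b \<Rightarrow> 'p) set \<Rightarrow> 'b \<Rightarrow> 'y"
  assumes "cu_semigroup S" and "cu_semigroup T" and "cu_semigroup P"
    and "is_cu_tensor S T X t TYPE('p)"
    and "is_cu_tensor S T X t TYPE('x)"
    and "is_cu_tensor S T X t TYPE('y)"
    and "is_cu_tensor (ihom T P) T Y u TYPE('p)"
  shows
    "(bij_betw (adj S T P X t) (cu_mor S (ihom T P)) (cu_mor X P)) \<and>
     (adj_counit T P Y u \<in> cu_mor Y P) \<and>
     (adj_unit S T X t \<in> cu_mor S (ihom T X)) \<and>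
     (\<forall>f\<in>cu_mor S (ihom T P).
           tensor_map S T X t Y u f (cu_id T) \<in> cu_mor X Y \<and>
           adj S T P X t f =
             compose (carrier X) (adj_counit T P Y u) (tensor_map S T X t Y u f (cu_id T))) \<and>
     (\<forall>g\<in>cu_mor X P.
           ihom_push T X P g \<in> cu_mor (ihom T X) (ihom T P) \<and>
           adj_inv S T P X t g = compose (carrier S) (ihom_push T X P g) (adj_unit S T X t)) \<and>
     (\<forall>f\<in>cu_mor S (ihom T P).
           f = compose (carrier S)
                 (ihom_push T X P
                   (compose (carrier X) (adj_counit T P Y u) (tensor_map S T X t Y u f (cu_id T))))
                 (adj_unit S T X t)) \<and>
     (\<forall>g\<in>cu_mor X P.
           g = compose (carrier X) (adj_counit T P Y u)
                 (tensor_map S T X t Y u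
                   (compose (carrier S) (ihom_push T X P g) (adj_unit S T X t)) (cu_id T)))"
proof -
  have X: "cu_semigroup X" and t: "cu_bimorphism S T X t"
    using assms(4) by (rule cu_tensor_cu_semigroup, rule cu_tensor_bimorphism)
  have Y: "cu_semigroup Y" and u: "cu_bimorphism (ihom T P) T Y u"
    using assms(7) by (rule cu_tensor_cu_semigroup, rule cu_tensor_bimorphism)
  interpret S: cu_semigroup S by fact
  interpret X: cu_semigroup X by fact
  interpret TP: cu_pair T P using assms(2,3) by (rule cu_pair.intro)
  let ?e = "adj_counit T P Y u" and ?d = "adj_unit S T X t"
  let ?m = "\<lambda>f. tensor_map S T X t Y u f (cu_id T)"
  have id_ihom: "cu_id (ihom T P) \<in> cu_mor (ihom T P) (ihom T P)"
    by (intro cu_id_mor TP.ihom_zero_closed TP.ihom_add_closed)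
  have e: "?e \<in> cu_mor Y P" unfolding adj_counit_def
    by (rule adj_spec(1)[OF assms(2,3,7) id_ihom])
  \<comment> \<open>The counit is evaluation: it is \<open>adj\<close> of the identity.\<close>
  have e_eq: "?e (u F b) = endpoint T P F b" if "F \<in> carrier (ihom T P)" "b \<in> carrier T" for F b
    using adj_spec(2)[OF assms(2,3,7) id_ihom that] that by (simp add: adj_counit_def cu_id_def)
  have id_X: "cu_id X \<in> cu_mor X X" by (intro cu_id_mor X.zero_closed X.add_closed)
  have d: "?d \<in> cu_mor S (ihom T X)" unfolding adj_unit_def
    by (rule adj_inv_spec(1)[OF assms(1,2) X assms(5) id_X])
  \<comment> \<open>\<open>adj\<close> sends the unit to the identity of X; evaluating this at
    \<open>t a b\<close> yields the universal bimorphism as endpoint of the unit.\<close>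
  have d_eq: "endpoint T X (?d a) b = t a b" if "a \<in> carrier S" "b \<in> carrier T" for a b
    using adj_spec(2)[OF assms(2) X assms(5) d that] adj_inv_spec(2)[OF assms(1,2) X assms(5) id_X]
      bimorphism_closed[OF t that]
    by (simp add: adj_unit_def cu_id_def)
  have id_T: "cu_id T \<in> cu_mor T T" by (intro cu_id_mor TP.T.zero_closed TP.T.add_closed)
  have m: "?m f \<in> cu_mor X Y" "adj S T P X t f = compose (carrier X) ?e (?m f)"
    if f: "f \<in> cu_mor S (ihom T P)" for f
  proof -
    note spec = tensor_map_spec[OF assms(6) Y u f id_T]
    show "?m f \<in> cu_mor X Y" by (rule spec(1))
    show "adj S T P X t f = compose (carrier X) ?e (?m f)"
    proof (rule cu_tensor_eqI[OF assms(4,3) adj_spec(1)[OF assms(2-4) f]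
          cu_mor_compose[OF spec(1) e X.positively_ordered_semigroup_axioms]])
      fix a b assume ab: "a \<in> carrier S" "b \<in> carrier T"
      show "adj S T P X t f (t a b) = compose (carrier X) ?e (?m f) (t a b)"
        using adj_spec(2)[OF assms(2-4) f ab] spec(2)[OF ab] bimorphism_closed[OF t ab]
          e_eq[OF gen_cu_mor_closed[OF cu_mor_gen[OF f] ab(1)] ab(2)] ab(2)
        by (simp add: compose_def cu_id_def)
    qed
  qed
  have p: "ihom_push T X P g \<in> cu_mor (ihom T X) (ihom T P)"
    "adj_inv S T P X t g = compose (carrier S) (ihom_push T X P g) ?d"
    if g: "g \<in> cu_mor X P" for g
  proof -
    interpret cu_push T X P g
      using assms(2,3) X g by (intro cu_push.intro cu_pair.intro cu_push_axioms.intro)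
    show "ihom_push T X P g \<in> cu_mor (ihom T X) (ihom T P)" by (rule ihom_push_mor)
    have gd: "compose (carrier S) (ihom_push T X P g) ?d \<in> cu_mor S (ihom T P)"
      by (rule cu_mor_compose[OF d ihom_push_mor S.positively_ordered_semigroup_axioms])
    \<comment> \<open>It is easier to apply \<open>adj\<close> to the candidate and recover g on
      elementary tensors, where naturality of the endpoint and \<open>d_eq\<close> suffice;
      injectivity of \<open>adj\<close> then gives the formula for the inverse.\<close>
    have "adj S T P X t (compose (carrier S) (ihom_push T X P g) ?d) = g"
    proof (rule cu_tensor_eqI[OF assms(4,3) adj_spec(1)[OF assms(2-4) gd] g])
      fix a b assume ab: "a \<in> carrier S" "b \<in> carrier T"
      show "adj S T P X t (compose (carrier S) (ihom_push T X P g) ?d) (t a b) = g (t a b)"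
        using adj_spec(2)[OF assms(2-4) gd ab] d_eq[OF ab] ab
          endpoint_ihom_push[OF gen_cu_mor_closed[OF cu_mor_gen[OF d] ab(1)] ab(2)]
        by (simp add: compose_def)
    qed
    then show "adj_inv S T P X t g = compose (carrier S) (ihom_push T X P g) ?d"
      using adj_inv_adj[OF assms(1-4) gd] by simp
  qed
  \<comment> \<open>Both closing identities say that \<open>adj\<close> and \<open>adj_inv\<close>
    are mutually inverse, rewritten with the two formulas just proved.\<close>
  have "f = compose (carrier S) (ihom_push T X P (compose (carrier X) ?e (?m f))) ?d"
    if f: "f \<in> cu_mor S (ihom T P)" for f
    using p(2)[OF adj_spec(1)[OF assms(2-4) f]] adj_inv_adj[OF assms(1-4) f] m(2)[OF f] by simp
  moreover have "g = compose (carrier X) ?e (?m (compose (carrier S) (ihom_push T X P g) ?d))"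
    if g: "g \<in> cu_mor X P" for g
    using m(2)[OF adj_inv_spec(1)[OF assms(1-4) g]] adj_inv_spec(2)[OF assms(1-4) g] p(2)[OF g] by simp
  ultimately show ?thesis using adj_bij_betw[OF assms(1-4)] e d m p by blast
qed

end
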